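(* For $0<|q|<1$, $$\sum_{n=0}^{\infty}\frac{(-q;q)_n}{(q;q)_{2n+1}}\frac{q^{3n^2/2+5n/2+1}}{1+q^{n+1}}+\frac{2}{\varphi(-q)}\sum_{n=-\infty}^{\infty}\left(\frac{q^{15n^2/2+n/2}}{1+q^{3n}}-\frac{q^{15n^2/2+11n/2+1}}{1+q^{3n+1}}\right)$$ $$=\frac{1}{\varphi(-q)}\Big((-q^7,-q^8,q^{15};q^{15})_\infty-q(-q^2,-q^{13},q^{15};q^{15})_\infty\Big),$$ where $\varphi(-q)=\dfrac{(q;q)_\infty}{(-q;q)_\infty}$.
   Context: $(x;p)_\infty=\prod_{n\ge0}(1-xp^n)$, $(x;p)_n=\prod_{i=0}^{n-1}(1-xp^i)$ for $n\ge0$, and $(a_1,\dots,a_r;p)_\infty=(a_1;p)_\infty\cdots(a_r;p)_\infty$. All exponents of $q$ are integers. *)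

theory Defs
  imports "HOL-Analysis.Analysis"
begin

definition qpoch :: "complex \<Rightarrow> complex \<Rightarrow> nat \<Rightarrow> complex" where
  "qpoch x p n = (\<Prod>i<n. 1 - x * p ^ i)"

text \<open>The infinite product converges in the sense of \<^const>\<open>has_prod\<close>
  for every \<open>x\<close> when \<open>norm p < 1\<close>; vanishing factors are allowed.\<close>

definition qpoch_inf :: "complex \<Rightarrow> complex \<Rightarrow> complex" where
  "qpoch_inf x p = (\<Prod>n. 1 - x * p ^ n)"

definition qpoch_inf_list :: "complex list \<Rightarrow> complex \<Rightarrow> complex" where
  "qpoch_inf_list as p = (\<Prod>a\<leftarrow>as. qpoch_inf a p)"

text \<open>\<open>phi_neg q\<close> stands for \<open>\<phi>(-q)\<close>, not for \<open>\<phi>(q)\<close>.\<close>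

definition phi_neg :: "complex \<Rightarrow> complex" where
  "phi_neg q = qpoch_inf q q / qpoch_inf (- q) q"

end

theory Submission
  imports Defs "HOL-Library.Nat_Bijection"
begin

text \<open>
  Put \<open>\<delta>\<^sub>n = (-1; q)\<^sub>n q\<^bsup>n(n+1)/2\<^esup>\<close>. With \<open>m = n + 1\<close>, the \<open>n\<close>-th term of the first series
  equals \<open>\<delta>\<^sub>m \<beta>\<^sub>m / 2\<close>, where \<open>\<beta>\<^sub>m = (1 - q\<^bsup>m\<^esup>) q\<^bsup>m\<^sup>2 - m\<^esup> / (q; q)\<^bsub>2m\<^esub>\<close> is the difference of
  Slater's Bailey pairs A(7) and A(5), so that \<open>\<beta>\<^sub>m = (\<Sum>j. \<alpha>\<^sub>j / ((q; q)\<^bsub>m-j\<^esub> (q; q)\<^bsub>m+j\<^esub>))\<close>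
  over all integers \<open>j\<close>, with \<open>\<alpha>\<^sub>j = 0\<close> for \<open>j \<equiv> 2 (mod 3)\<close>. A limiting case of the
  q-Gauss sum gives
  \<open>(\<Sum>n. \<delta>\<^sub>n / ((q; q)\<^bsub>n-j\<^esub> (q; q)\<^bsub>n+j\<^esub>)) = (2 / \<phi>(-q)) q\<^bsup>j(j+1)/2\<^esup> / (1 + q\<^bsup>j\<^esup>)\<close>, and interchanging
  the summations turns the first series into a bilateral sum with the factors
  \<open>(1 - q\<^bsup>j\<^esup>) / (1 + q\<^bsup>j\<^esup>)\<close>. Writing \<open>\<mp>(1 - x) / (1 + x) = \<plusminus>(1 - 2 / (1 + x))\<close> splits it into
  the second series and two theta series, which the Jacobi triple product evaluates.
\<close>

subsection \<open>q-Pochhammer symbols\<close>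

lemma qpoch_0 [simp]: "qpoch x p 0 = 1"
  by (simp add: qpoch_def)

lemma qpoch_Suc: "qpoch x p (Suc n) = qpoch x p n * (1 - x * p ^ n)"
  by (simp add: qpoch_def)

lemma qpoch_add: "qpoch x p (m + n) = qpoch x p m * qpoch (x * p ^ m) p n"
  by (induction n) (simp_all add: qpoch_Suc power_add mult_ac)

lemma qpoch_Suc_left: "qpoch x p (Suc n) = (1 - x) * qpoch (x * p) p n"
  using qpoch_add[of x p 1 n] by (simp add: qpoch_Suc)

lemma qpoch_eq_0_iff: "qpoch x p n = 0 \<longleftrightarrow> (\<exists>i<n. x * p ^ i = 1)"
  by (auto simp: qpoch_def)

lemma has_prod_qpoch_inf:
  assumes "norm p < 1"
  shows "(\<lambda>n. 1 - x * p ^ n) has_prod qpoch_inf x p"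
proof -
  have "summable (\<lambda>i. norm ((1 - x * p ^ i) - 1))"
    using assms by (simp add: norm_mult norm_power summable_mult)
  then have "convergent_prod (\<lambda>n. 1 - x * p ^ n)"
    by (intro abs_convergent_prod_imp_convergent_prod summable_imp_abs_convergent_prod)
  then show ?thesis
    unfolding qpoch_inf_def by (rule convergent_prod_has_prod)
qed

lemma qpoch_tendsto:
  assumes "norm p < 1"
  shows "(\<lambda>n. qpoch x p n) \<longlonglongrightarrow> qpoch_inf x p"
  unfolding qpoch_def using has_prod_imp_tendsto'[OF has_prod_qpoch_inf[OF assms]] .

lemma qpoch_inf_eq_0_iff:
  assumes "norm p < 1"
  shows "qpoch_inf x p = 0 \<longleftrightarrow> (\<exists>n. x * p ^ n = 1)"
  using has_prod_eq_0_iff[OF has_prod_qpoch_inf[OF assms, of x]] by auto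

lemma qpoch_inf_split:
  assumes "norm p < 1"
  shows "qpoch_inf x p = qpoch x p n * qpoch_inf (x * p ^ n) p"
proof (rule LIMSEQ_unique)
  show "(\<lambda>m. qpoch x p (m + n)) \<longlonglongrightarrow> qpoch_inf x p"
    using qpoch_tendsto[OF assms] by (rule LIMSEQ_ignore_initial_segment)
  show "(\<lambda>m. qpoch x p (m + n)) \<longlonglongrightarrow> qpoch x p n * qpoch_inf (x * p ^ n) p"
    unfolding add.commute[of _ n] qpoch_add by (intro tendsto_intros qpoch_tendsto assms)
qed

lemma qpoch_bounded:
  assumes "norm p < 1"
  obtains B where "B > 0" "\<And>n. norm (qpoch x p n) \<le> B"
  using Bseq_def[of "qpoch x p"] convergent_imp_Bseq[OF convergentI[OF qpoch_tendsto[OF assms]]]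
  by blast

lemma inverse_qpoch_bounded:
  assumes "norm p < 1" "\<And>n. x * p ^ n \<noteq> 1"
  obtains B where "B > 0" "\<And>n. norm (inverse (qpoch x p n)) \<le> B"
proof -
  have "qpoch_inf x p \<noteq> 0"
    using assms by (simp add: qpoch_inf_eq_0_iff)
  then have "(\<lambda>n. inverse (qpoch x p n)) \<longlonglongrightarrow> inverse (qpoch_inf x p)"
    by (intro tendsto_inverse qpoch_tendsto assms)
  then have "Bseq (\<lambda>n. inverse (qpoch x p n))"
    by (intro convergent_imp_Bseq convergentI)
  then show thesis
    using that unfolding Bseq_def by blast
qed

lemma power_neq_1:
  fixes q :: "'a::real_normed_div_algebra"
  assumes "norm q < 1" "n > 0"
  shows "q ^ n \<noteq> 1"
  using assms power_less_one_iff[of "norm q" n]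
  by (metis less_irrefl norm_ge_zero norm_one norm_power)

lemma qpoch_self_nonzero:
  assumes "norm q < 1"
  shows "qpoch q q n \<noteq> 0"
  using power_neq_1[OF assms, of "Suc i" for i] by (auto simp: qpoch_eq_0_iff)

section \<open>Reciprocal q-factorials extended by zero to negative indices\<close>

definition qrfact :: "complex \<Rightarrow> int \<Rightarrow> complex" where
  "qrfact q j = (if j < 0 then 0 else inverse (qpoch q q (nat j)))"

lemma qrfact_neg [simp]: "j < 0 \<Longrightarrow> qrfact q j = 0"
  by (simp add: qrfact_def)

lemma qrfact_of_nat: "qrfact q (int n) = inverse (qpoch q q n)"
  by (simp add: qrfact_def)

text \<open>The extension by zero is consistent with the recurrence: at \<open>j = 0\<close> the
  factor \<open>1 - q powi j\<close> vanishes, matching the value 0 at index -1. No range conditions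
  are therefore needed in the Pascal rules below.\<close>

lemma qrfact_rec:
  assumes "norm q < 1"
  shows "(1 - q powi j) * qrfact q j = qrfact q (j - 1)"
proof (cases "j \<le> 0")
  case True
  then show ?thesis by (cases "j = 0") auto
next
  case False
  then obtain n where j: "j = int (Suc n)"
    by (metis not_le zero_less_imp_eq_int gr0_implies_Suc)
  have "q * q ^ n \<noteq> 1"
    using power_neq_1[OF assms, of "Suc n"] by simp
  have "(1 - q powi j) * qrfact q j = (1 - q * q ^ n) * inverse (qpoch q q (Suc n))"
    unfolding j qrfact_of_nat power_int_of_nat by simp
  also have "\<dots> = inverse (qpoch q q n)"
    using \<open>q * q ^ n \<noteq> 1\<close> by (simp add: qpoch_Suc)
  also have "\<dots> = qrfact q (j - 1)"
    by (simp add: j qrfact_of_nat)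
  finally show ?thesis .
qed

lemma qrfact_bounded:
  assumes "norm q < 1"
  obtains B where "B > 0" "\<And>j. norm (qrfact q j) \<le> B"
proof -
  obtain B where "B > 0" "\<And>n. norm (inverse (qpoch q q n)) \<le> B"
    using inverse_qpoch_bounded[of q q] assms power_neq_1[of q "Suc n" for n] by auto
  then show thesis
    by (intro that[of B]) (auto simp: qrfact_def less_imp_le)
qed

subsection \<open>Sums against Gaussian binomial coefficients\<close>

text \<open>Split 1 - q^(a+b) = (1 - q^a) + q^a (1 - q^b); \<open>qrfact_rec\<close> absorbs each
  bracket into one of the two factors.\<close>

lemma qrfact_pascal:
  assumes "norm q < 1" "q \<noteq> 0"
  shows "(1 - q powi (a + b)) * (qrfact q a * qrfact q b)
    = qrfact q (a - 1) * qrfact q b + q powi a * (qrfact q a * qrfact q (b - 1))"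
  unfolding qrfact_rec[OF assms(1), symmetric] using assms(2)
  by (simp add: power_int_add algebra_simps)

text \<open>With \<open>[n, j]\<close> the Gaussian binomial coefficient, this is
  \<open>(\<Sum>k. c k * [a + b, a - d * k]) / (q; q)\<^bsub>a + b\<^esub>\<close>.\<close>

definition qbin_sum :: "complex \<Rightarrow> int \<Rightarrow> (int \<Rightarrow> complex) \<Rightarrow> int \<Rightarrow> int \<Rightarrow> complex" where
  "qbin_sum q d c a b = (\<Sum>\<^sub>\<infinity>k. c k * (qrfact q (a - d * k) * qrfact q (b + d * k)))"

text \<open>Outside the window one of the two indices is negative, so every \<open>qbin_sum\<close>
  is a finite sum and convergence is automatic.\<close>

lemma qbin_term_eq_0:
  assumes "d > 0" "k \<notin> {- \<bar>b\<bar>..\<bar>a\<bar>}"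
  shows "qrfact q (a - d * k) * qrfact q (b + d * k) = 0"
proof (cases "k < - \<bar>b\<bar>")
  case True
  then have "d * k < d * (- \<bar>b\<bar>)" using assms(1) by (simp only: mult_less_cancel_left_pos)
  moreover have "d * \<bar>b\<bar> \<ge> \<bar>b\<bar>" using assms(1) mult_right_mono[of 1 d "\<bar>b\<bar>"] by simp
  ultimately show ?thesis by simp
next
  case False
  then have "k > \<bar>a\<bar>" using assms(2) by auto
  then have "d * k > d * \<bar>a\<bar>" using assms(1) by (simp only: mult_less_cancel_left_pos)
  moreover have "d * \<bar>a\<bar> \<ge> \<bar>a\<bar>" using assms(1) mult_right_mono[of 1 d "\<bar>a\<bar>"] by simp
  ultimately show ?thesis by simp
qed

lemma qbin_term_summable:
  assumes "d > 0"
  shows "(\<lambda>k. c k * (qrfact q (a - d * k) * qrfact q (b + d * k))) summable_on UNIV"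
proof (rule finite_nonzero_values_imp_summable_on)
  have "{k \<in> UNIV. c k * (qrfact q (a - d * k) * qrfact q (b + d * k)) \<noteq> 0} \<subseteq> {- \<bar>b\<bar>..\<bar>a\<bar>}"
    using qbin_term_eq_0[OF assms] by fastforce
  then show "finite {k \<in> UNIV. c k * (qrfact q (a - d * k) * qrfact q (b + d * k)) \<noteq> 0}"
    by (rule finite_subset) simp
qed

lemma qbin_term_has_sum:
  assumes "d > 0"
  shows "((\<lambda>k. c k * (qrfact q (a - d * k) * qrfact q (b + d * k))) has_sum qbin_sum q d c a b) UNIV"
  unfolding qbin_sum_def using qbin_term_summable[OF assms] by (rule has_sum_infsum)

lemma qbin_sum_cong: "(\<And>k. c k = c' k) \<Longrightarrow> qbin_sum q d c a b = qbin_sum q d c' a b"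
  by (simp add: qbin_sum_def)

lemma qbin_sum_cmult: "qbin_sum q d (\<lambda>k. x * c k) a b = x * qbin_sum q d c a b"
  unfolding qbin_sum_def by (simp add: mult.assoc infsum_cmult_right')

lemma qbin_sum_reflect: "qbin_sum q d c a b = qbin_sum q d (\<lambda>k. c (- k)) b a"
  unfolding qbin_sum_def
  by (rule infsum_reindex_bij_witness[of _ uminus uminus]) (auto simp: mult.commute)

lemma qbin_sum_shift: "qbin_sum q d c a b = qbin_sum q d (\<lambda>k. c (k + 1)) (a - d) (b + d)"
  unfolding qbin_sum_def
  by (rule infsum_reindex_bij_witness[of _ "\<lambda>k. k + 1" "\<lambda>k. k - 1"]) (auto simp: algebra_simps)

text \<open>The two indices add up to \<open>a + b\<close> for every \<open>k\<close>, so the Pascal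
  rule applies termwise with a common left factor. Only q^(a - dk) depends on \<open>k\<close>, and
  its part q^(-dk) moves into the coefficients.\<close>

lemma qbin_sum_pascal_left:
  assumes "norm q < 1" "q \<noteq> 0" "d > 0"
  shows "(1 - q powi (a + b)) * qbin_sum q d c a b
    = qbin_sum q d c (a - 1) b + q powi a * qbin_sum q d (\<lambda>k. c k * q powi (- d * k)) a (b - 1)"
proof -
  let ?u = "\<lambda>k. qrfact q (a - d * k)" and ?v = "\<lambda>k. qrfact q (b + d * k)"
  have eq: "(1 - q powi (a + b)) * (c k * (?u k * ?v k))
      = c k * (qrfact q (a - 1 - d * k) * ?v k)
        + q powi a * (c k * q powi (- d * k) * (?u k * qrfact q (b - 1 + d * k)))" for k
  proof -
    have "(1 - q powi (a + b)) * (?u k * ?v k)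
      = qrfact q (a - 1 - d * k) * ?v k
        + q powi a * q powi (- d * k) * (?u k * qrfact q (b - 1 + d * k))"
      using qrfact_pascal[OF assms(1,2), of "a - d * k" "b + d * k"] assms(2)
      by (simp add: algebra_simps flip: power_int_add)
    from arg_cong[OF this, of "\<lambda>x. c k * x"] show ?thesis
      by (simp only: distrib_left mult_ac)
  qed
  have "((\<lambda>k. (1 - q powi (a + b)) * (c k * (?u k * ?v k))) has_sum
      (1 - q powi (a + b)) * qbin_sum q d c a b) UNIV"
    by (intro has_sum_cmult_right qbin_term_has_sum assms)
  moreover have "((\<lambda>k. (1 - q powi (a + b)) * (c k * (?u k * ?v k))) has_sum
      (qbin_sum q d c (a - 1) b
        + q powi a * qbin_sum q d (\<lambda>k. c k * q powi (- d * k)) a (b - 1))) UNIV"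
    unfolding eq by (intro has_sum_add has_sum_cmult_right qbin_term_has_sum assms)
  ultimately show ?thesis by (rule has_sum_unique)
qed

text \<open>The mirror image of \<open>qbin_sum_pascal_left\<close> under k -> -k, which exchanges
  \<open>a\<close> and \<open>b\<close>.\<close>

lemma qbin_sum_pascal_right:
  assumes "norm q < 1" "q \<noteq> 0" "d > 0"
  shows "(1 - q powi (a + b)) * qbin_sum q d c a b
    = qbin_sum q d c a (b - 1) + q powi b * qbin_sum q d (\<lambda>k. c k * q powi (d * k)) (a - 1) b"
  using qbin_sum_pascal_left[OF assms, of b a "\<lambda>k. c (- k)"]
  unfolding qbin_sum_reflect[of q d _ b] qbin_sum_reflect[of q d _ "b - 1"]
  by (simp add: add.commute)

subsection \<open>Slater's Bailey pairs A(5) and A(7)\<close>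

text \<open>\<open>slater_A7\<close> and \<open>slater_A5\<close> extend the sums behind Slater's Bailey pairs A(7) and A(5)
  to unequal arguments; this makes the pair closed under the two Pascal recurrences.\<close>

definition slater_A7 :: "complex \<Rightarrow> int \<Rightarrow> int \<Rightarrow> complex" where
  "slater_A7 q a b = qbin_sum q 3 (\<lambda>k. q powi (3 * k\<^sup>2 + 2 * k)) a b
    - qbin_sum q 3 (\<lambda>k. q powi (3 * k\<^sup>2 + 4 * k + 1)) (a - 1) (b + 1)"

definition slater_A5 :: "complex \<Rightarrow> int \<Rightarrow> int \<Rightarrow> complex" where
  "slater_A5 q a b = qbin_sum q 3 (\<lambda>k. q powi (3 * k\<^sup>2 - k)) a b
    - qbin_sum q 3 (\<lambda>k. q powi (3 * k\<^sup>2 + k)) (a - 1) (b + 1)"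

text \<open>The twist by q^(-3k) lowers the A(7) exponents to those of A(5), so the left Pascal rule
  carries one family into the other. The right rule, with q^(3k), leads back in
  \<open>slater_A5_pascal\<close>.\<close>

lemma slater_A7_pascal:
  assumes q: "norm q < 1" "q \<noteq> 0"
  shows "(1 - q powi (a + b)) * slater_A7 q a b
    = slater_A7 q (a - 1) b + q powi a * slater_A5 q a (b - 1)"
proof -
  let ?c = "\<lambda>k::int. q powi (3 * k\<^sup>2 + 2 * k)" and ?d = "\<lambda>k::int. q powi (3 * k\<^sup>2 + 4 * k + 1)"
  have "?c k * q powi (- 3 * k) = q powi (3 * k\<^sup>2 - k)" for k
    using q by (simp add: algebra_simps flip: power_int_add)
  then have 1: "(1 - q powi (a + b)) * qbin_sum q 3 ?c a b
      = qbin_sum q 3 ?c (a - 1) b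
        + q powi a * qbin_sum q 3 (\<lambda>k. q powi (3 * k\<^sup>2 - k)) a (b - 1)"
    using qbin_sum_pascal_left[OF q, of 3 a b ?c] by simp
  \<comment> \<open>The surplus factor \<open>q\<close> compensates for the first argument being
    \<open>a - 1\<close>: it turns q^(a-1) into the common factor q^a.\<close>
  have "?d k * q powi (- 3 * k) = q * q powi (3 * k\<^sup>2 + k)" for k
    using q by (simp add: algebra_simps flip: power_int_add power_int_add_1 power_int_add_1')
  then have 2: "(1 - q powi (a + b)) * qbin_sum q 3 ?d (a - 1) (b + 1)
      = qbin_sum q 3 ?d (a - 2) (b + 1)
        + q powi a * qbin_sum q 3 (\<lambda>k. q powi (3 * k\<^sup>2 + k)) (a - 1) b"
    using qbin_sum_pascal_left[OF q, of 3 "a - 1" "b + 1" ?d] q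
    by (simp add: qbin_sum_cmult power_int_diff)
  show ?thesis
    unfolding slater_A7_def slater_A5_def right_diff_distrib 1 2
    by (simp add: algebra_simps)
qed

lemma slater_A5_pascal:
  assumes q: "norm q < 1" "q \<noteq> 0"
  shows "(1 - q powi (a + b)) * slater_A5 q a b
    = slater_A5 q a (b - 1) + q powi b * slater_A7 q (a - 1) b"
proof -
  let ?c = "\<lambda>k::int. q powi (3 * k\<^sup>2 - k)" and ?d = "\<lambda>k::int. q powi (3 * k\<^sup>2 + k)"
  have "?c k * q powi (3 * k) = q powi (3 * k\<^sup>2 + 2 * k)" for k
    using q by (simp add: algebra_simps flip: power_int_add)
  then have 1: "(1 - q powi (a + b)) * qbin_sum q 3 ?c a b
      = qbin_sum q 3 ?c a (b - 1)
        + q powi b * qbin_sum q 3 (\<lambda>k. q powi (3 * k\<^sup>2 + 2 * k)) (a - 1) b"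
    using qbin_sum_pascal_right[OF q, of 3 a b ?c] by simp
  have "q * (?d k * q powi (3 * k)) = q powi (3 * k\<^sup>2 + 4 * k + 1)" for k
    using q by (simp add: algebra_simps flip: power_int_add power_int_add_1 power_int_add_1')
  then have "q * qbin_sum q 3 (\<lambda>k. ?d k * q powi (3 * k)) (a - 2) (b + 1)
      = qbin_sum q 3 (\<lambda>k. q powi (3 * k\<^sup>2 + 4 * k + 1)) (a - 2) (b + 1)"
    by (simp add: qbin_sum_cmult[symmetric])
  then have 2: "(1 - q powi (a + b)) * qbin_sum q 3 ?d (a - 1) (b + 1)
      = qbin_sum q 3 ?d (a - 1) b
        + q powi b * qbin_sum q 3 (\<lambda>k. q powi (3 * k\<^sup>2 + 4 * k + 1)) (a - 2) (b + 1)"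
    using qbin_sum_pascal_right[OF q, of 3 "a - 1" "b + 1" ?d] q
    by (simp add: power_int_add_1 mult.assoc)
  show ?thesis
    unfolding slater_A7_def slater_A5_def right_diff_distrib 1 2
    by (simp add: algebra_simps)
qed

text \<open>At these arguments the reflection k -> -k carries the first sum exactly into the
  subtracted one.\<close>

lemma slater_A5_vanish: "slater_A5 q (n + 1) n = 0"
  unfolding slater_A5_def by (subst qbin_sum_reflect) simp

text \<open>Here a reflection followed by a shift of \<open>k\<close> by one is needed: 3(k+1)^2 -
  2(k+1) = 3k^2 + 4k + 1.\<close>

lemma slater_A7_vanish: "slater_A7 q n (n + 2) = 0"
proof -
  have "qbin_sum q 3 (\<lambda>k. q powi (3 * k\<^sup>2 + 2 * k)) n (n + 2)
      = qbin_sum q 3 (\<lambda>k. q powi (3 * (k + 1)\<^sup>2 - 2 * (k + 1))) (n - 1) (n + 3)"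
    by (subst qbin_sum_reflect, subst qbin_sum_shift)
      (simp only: power2_minus diff_conv_add_uminus mult_minus_right, simp)
  also have "\<dots> = qbin_sum q 3 (\<lambda>k. q powi (3 * k\<^sup>2 + 4 * k + 1)) (n - 1) (n + 3)"
    by (intro qbin_sum_cong) (simp add: power2_eq_square algebra_simps)
  finally show ?thesis
    by (simp add: slater_A7_def add.assoc)
qed

text \<open>On the diagonal one of the two Pascal terms is a value of \<open>slater_A5\<close> at
  \<open>(n, n - 1)\<close>, which vanishes. The same happens in \<open>slater_A7_diag\<close>, so
  both diagonals are reduced to the single value \<open>slater_A7 q (n - 1) n\<close>.\<close>

lemma slater_A5_diag:
  assumes q: "norm q < 1" "q \<noteq> 0"
  shows "(1 - q powi (2 * n)) * slater_A5 q n n = q powi n * slater_A7 q (n - 1) n"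
  using slater_A5_pascal[OF q, of n n] slater_A5_vanish[of q "n - 1"] by simp

lemma slater_A7_diag:
  assumes q: "norm q < 1" "q \<noteq> 0"
  shows "(1 - q powi (2 * n)) * slater_A7 q n n = slater_A7 q (n - 1) n"
  using slater_A7_pascal[OF q, of n n] slater_A5_vanish[of q "n - 1"] by simp

lemma qbin_sum_3_0_0: "qbin_sum q 3 c 0 0 = c 0"
proof -
  have "k \<noteq> 0 \<Longrightarrow> qrfact q (- (3 * k)) * qrfact q (3 * k) = 0" for k
    by (cases "k > 0") auto
  then have "((\<lambda>k. c k * (qrfact q (0 - 3 * k) * qrfact q (0 + 3 * k))) has_sum c 0) UNIV"
    by (intro has_sum_finite_neutralI[of "{0}"]) (auto simp: qrfact_def)
  then show ?thesis
    by (simp add: qbin_sum_def infsumI)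
qed

lemma qbin_sum_3_m1_1: "qbin_sum q 3 c (- 1) 1 = 0"
proof -
  have "qrfact q (- 1 - 3 * k) * qrfact q (1 + 3 * k) = 0" for k
    by (cases "k \<ge> 0") auto
  then show ?thesis
    by (simp only: qbin_sum_def mult_zero_right infsum_0_simp)
qed

text \<open>Compare the two diagonal reductions and cancel 1 - q^(2n). This factor is zero for
  \<open>n = 0\<close>, where both sides are computed directly.\<close>

lemma slater_A5_eq_A7:
  assumes q: "norm q < 1" "q \<noteq> 0"
  shows "slater_A5 q (int n) (int n) = q ^ n * slater_A7 q (int n) (int n)"
proof (cases "n = 0")
  case True
  then show ?thesis
    by (simp add: slater_A5_def slater_A7_def qbin_sum_3_0_0 qbin_sum_3_m1_1)
next
  case False
  have "q powi (2 * int n) = q ^ (2 * n)"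
    by (simp add: power_int_def nat_mult_distrib)
  then have "1 - q powi (2 * int n) \<noteq> 0"
    using power_neq_1[OF q(1), of "2 * n"] False by simp
  moreover have "(1 - q powi (2 * int n)) * slater_A5 q (int n) (int n)
      = (1 - q powi (2 * int n)) * (q ^ n * slater_A7 q (int n) (int n))"
    using slater_A5_diag[OF q, of "int n"] slater_A7_diag[OF q, of "int n"] by simp
  ultimately show ?thesis
    by (simp only: mult_cancel_left) simp
qed

text \<open>The induction step walks from \<open>(n + 1, n + 1)\<close> over
  \<open>(n, n + 1)\<close> to \<open>(n, n)\<close>, gaining the two new factors of the
  denominator. The second move uses \<open>slater_A7_vanish\<close> and lands on
  \<open>slater_A5\<close>, which \<open>slater_A5_eq_A7\<close> converts back; together these
  contribute q^(2n).\<close>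

lemma slater_A7_closed:
  assumes q: "norm q < 1" "q \<noteq> 0"
  shows "slater_A7 q (int n) (int n) = q ^ (n\<^sup>2 - n) / qpoch q q (2 * n)"
proof (induction n)
  case 0
  then show ?case
    by (simp add: slater_A7_def qbin_sum_3_0_0 qbin_sum_3_m1_1)
next
  case (Suc n)
  define N where "N = int (Suc n)"
  have nz: "1 - q * q ^ m \<noteq> 0" for m
    using power_neq_1[OF q(1), of "Suc m"] by simp
  have "nat (2 * N) = Suc (2 * n + 1)" "nat (2 * N - 1) = Suc (2 * n)"
    by (simp_all add: N_def)
  then have N: "q powi (2 * N) = q * q ^ (2 * n + 1)" "q powi (2 * N - 1) = q * q ^ (2 * n)"
      "N - 1 = int n"
    by (simp_all add: N_def power_int_def)
  have "(1 - q powi (2 * N - 1)) * slater_A7 q (N - 1) N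
      = q powi (N - 1) * slater_A5 q (N - 1) (N - 1)"
    using slater_A7_pascal[OF q, of "N - 1" N] slater_A7_vanish[of q "N - 2"] by simp
  then have "(1 - q * q ^ (2 * n)) * slater_A7 q (int n) N
      = q ^ (2 * n) * slater_A7 q (int n) (int n)"
    unfolding N slater_A5_eq_A7[OF q] by (simp flip: power_add mult.assoc mult_2)
  moreover have "(1 - q * q ^ (2 * n + 1)) * slater_A7 q N N = slater_A7 q (int n) N"
    using slater_A7_diag[OF q, of N] unfolding N .
  ultimately have "(1 - q * q ^ (2 * n)) * ((1 - q * q ^ (2 * n + 1)) * slater_A7 q N N)
      = q ^ (2 * n) * q ^ (n\<^sup>2 - n) / qpoch q q (2 * n)"
    unfolding Suc by simp
  moreover have "q ^ (2 * n) * q ^ (n\<^sup>2 - n) = q ^ ((Suc n)\<^sup>2 - Suc n)"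
    by (simp add: power2_eq_square algebra_simps flip: power_add)
  moreover have "qpoch q q (2 * Suc n)
      = qpoch q q (2 * n) * (1 - q * q ^ (2 * n)) * (1 - q * q ^ (2 * n + 1))"
    by (simp add: qpoch_Suc)
  ultimately show ?case
    using nz[of "2 * n"] nz[of "2 * n + 1"] qpoch_self_nonzero[OF q(1), of "2 * n"]
    unfolding N_def[symmetric] by (simp only: nonzero_eq_divide_eq mult_eq_0_iff simp_thms mult_ac)
qed

subsection \<open>The Jacobi triple product\<close>

lemma triangular_Suc: "Suc n * n div 2 = n * (n - 1) div 2 + n"
proof -
  have "Suc n * n = n * (n - 1) + n * 2"
    by (cases n) simp_all
  then have "Suc n * n div 2 = (n * (n - 1) + n * 2) div 2" by (rule arg_cong)
  then show ?thesis by (simp only: div_mult_self1 zero_neq_numeral[symmetric] add.commute)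
qed

section \<open>Dominating series and Tannery's theorem over the integers\<close>

lemma summable_gauss:
  fixes x y :: real
  assumes "0 \<le> x" "x < 1" "0 \<le> y"
  shows "summable (\<lambda>k. y ^ k * x ^ (k * (k - 1) div 2))"
proof -
  \<comment> \<open>The ratio of consecutive terms is y x^n, which tends to 0.\<close>
  have "(\<lambda>n. y * x ^ n) \<longlonglongrightarrow> y * 0"
    using assms by (intro tendsto_intros LIMSEQ_power_zero) auto
  then have "eventually (\<lambda>n. y * x ^ n < 1 / 2) sequentially"
    by (rule order_tendstoD) simp
  then obtain N where N: "\<And>n. n \<ge> N \<Longrightarrow> y * x ^ n < 1 / 2"
    by (auto simp: eventually_sequentially)
  show ?thesis
  proof (rule summable_ratio_test[of "1 / 2" N])
    fix n assume "n \<ge> N"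
    have "y ^ Suc n * x ^ (Suc n * (Suc n - 1) div 2) = (y * x ^ n) * (y ^ n * x ^ (n * (n - 1) div 2))"
      using triangular_Suc[of n] by (simp add: power_add)
    also have "\<dots> \<le> 1 / 2 * (y ^ n * x ^ (n * (n - 1) div 2))"
      using N[OF \<open>n \<ge> N\<close>] assms by (intro mult_right_mono) auto
    finally show "norm (y ^ Suc n * x ^ (Suc n * (Suc n - 1) div 2))
        \<le> 1 / 2 * norm (y ^ n * x ^ (n * (n - 1) div 2))"
      using assms by (simp add: abs_mult)
  qed simp
qed

text \<open>Enumerating the integers by \<open>int_decode\<close> turns the unordered sums into
  absolutely convergent series, to which Tannery's theorem applies.\<close>

lemma tendsto_infsum_dominated:
  fixes f :: "nat \<Rightarrow> int \<Rightarrow> 'a::{real_normed_algebra, banach}"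
  assumes lim: "\<And>k. (\<lambda>n. f n k) \<longlonglongrightarrow> g k"
    and bound: "\<And>n k. norm (f n k) \<le> M k"
    and M: "M summable_on UNIV"
  shows "(\<lambda>n. \<Sum>\<^sub>\<infinity>k. f n k) \<longlonglongrightarrow> (\<Sum>\<^sub>\<infinity>k. g k)"
proof -
  have nonneg: "M k \<ge> 0" for k
    using norm_ge_zero bound[of 0 k] by (rule order_trans)
  have "(\<lambda>i. M (int_decode i)) summable_on UNIV"
    using M by (subst summable_on_reindex_bij_betw[OF bij_int_decode])
  then have sM: "summable (\<lambda>i. M (int_decode i))"
    using nonneg by (subst (asm) summable_on_UNIV_nonneg_real_iff)
  have conv: "(\<Sum>\<^sub>\<infinity>k. h k) = (\<Sum>i. h (int_decode i))" if "\<And>k. norm (h k) \<le> M k" for h :: "int \<Rightarrow> 'a"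
  proof -
    have s: "summable (\<lambda>i. norm (h (int_decode i)))"
      using that by (intro summable_comparison_test'[OF sM]) simp
    then have "((\<lambda>i. h (int_decode i)) has_sum (\<Sum>i. h (int_decode i))) UNIV"
      by (rule norm_summable_imp_has_sum) (rule summable_sums[OF summable_norm_cancel[OF s]])
    then have "(h has_sum (\<Sum>i. h (int_decode i))) UNIV"
      unfolding has_sum_reindex_bij_betw[OF bij_int_decode] .
    then show ?thesis by (rule infsumI)
  qed
  have "norm (g k) \<le> M k" for k
    using bound by (intro Lim_bounded[OF tendsto_norm[OF lim], of 0]) auto
  then have "(\<Sum>\<^sub>\<infinity>k. g k) = (\<Sum>i. g (int_decode i))"
    by (rule conv)
  moreover have "(\<Sum>\<^sub>\<infinity>k. f n k) = (\<Sum>i. f n (int_decode i))" for n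
    by (rule conv) (rule bound)
  moreover have "(\<lambda>n. \<Sum>i. f n (int_decode i)) \<longlonglongrightarrow> (\<Sum>i. g (int_decode i))"
  proof (rule tannerys_theorem[THEN conjunct2, THEN conjunct2])
    show "eventually (\<lambda>(i, n). norm (f n (int_decode i)) \<le> M (int_decode i))
        (at_top \<times>\<^sub>F sequentially)"
      using bound by (intro always_eventually) auto
  qed (use lim sM in auto)
  ultimately show ?thesis by (simp only:)
qed

section \<open>Theta coefficients, the finite triple product and its limit\<close>

definition theta_coeff :: "complex \<Rightarrow> complex \<Rightarrow> int \<Rightarrow> complex" where
  "theta_coeff q z k = z powi k * q powi (k * (k - 1) div 2)"

lemma triangular_plus_1: "(k + 1) * k div 2 = k * (k - 1) div 2 + (k :: int)"
proof -
  have "(k + 1) * k = k * (k - 1) + k * 2" by algebra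
  then have "(k + 1) * k div 2 = (k * (k - 1) + k * 2) div 2" by (rule arg_cong)
  also have "\<dots> = k * (k - 1) div 2 + k"
    by (subst div_mult_self1) (rule zero_neq_numeral[symmetric], rule add.commute)
  finally show ?thesis .
qed

lemma theta_coeff_0 [simp]: "theta_coeff q z 0 = 1"
  by (simp add: theta_coeff_def)

lemma theta_coeff_plus_1:
  assumes "q \<noteq> 0" "z \<noteq> 0"
  shows "theta_coeff q z (k + 1) = z * (theta_coeff q z k * q powi k)"
proof -
  have "(k + 1) * (k + 1 - 1) div 2 = k * (k - 1) div 2 + k"
    using triangular_plus_1[of k] by simp
  then have "theta_coeff q z (k + 1) = z powi (k + 1) * q powi (k * (k - 1) div 2 + k)"
    by (simp only: theta_coeff_def)
  then show ?thesis
    using assms by (simp add: theta_coeff_def power_int_add power_int_add_1 mult_ac)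
qed

lemma theta_coeff_summable:
  assumes "norm q < 1" "q \<noteq> 0" "z \<noteq> 0"
  shows "(\<lambda>k. norm (theta_coeff q z k)) summable_on UNIV"
proof -
  let ?f = "\<lambda>k. norm (theta_coeff q z k)"
  have tri: "int n * (int n - 1) div 2 = int (n * (n - 1) div 2)" for n
    by (cases n) (simp_all add: zdiv_int algebra_simps)
  have pos: "?f (int n) = norm z ^ n * norm q ^ (n * (n - 1) div 2)" for n
    by (simp add: theta_coeff_def tri norm_mult norm_power)
  \<comment> \<open>The negative half has the same shape as the positive one, with \<open>z\<close>
    replaced by \<open>q / z\<close>.\<close>
  have neg: "?f (- int n) = norm (q / z) ^ n * norm q ^ (n * (n - 1) div 2)" for n
  proof -
    have "- int n * (- int n - 1) div 2 = int n + int (n * (n - 1) div 2)"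
      using triangular_plus_1[of "int n"] tri[of n] by (simp add: algebra_simps)
    then show ?thesis
      using assms
      by (simp add: theta_coeff_def norm_mult norm_power power_add power_int_add power_int_minus
          norm_inverse norm_divide power_divide divide_simps)
  qed
  have "(\<lambda>n. ?f (int n)) summable_on UNIV" "(\<lambda>n. ?f (- int n)) summable_on UNIV"
    using summable_gauss[of "norm q" "norm z"] summable_gauss[of "norm q" "norm (q / z)"] assms(1)
    by (simp_all add: pos neg summable_on_UNIV_nonneg_real_iff del: norm_divide)
  then have "?f summable_on range int" "?f summable_on range (\<lambda>n. - int n)"
    by (simp_all add: summable_on_reindex inj_def o_def)
  then have "?f summable_on (range int \<union> range (\<lambda>n. - int n))"
    by (rule summable_on_union)
  moreover have "k \<in> range int \<union> range (\<lambda>n. - int n)" for k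
    by (cases k rule: int_cases2) auto
  then have "range int \<union> range (\<lambda>n. - int n) = UNIV" by auto
  ultimately show ?thesis by (simp only:)
qed

text \<open>With these coefficients the two sums of the Pascal rule coincide up to a factor: after
  shifting \<open>k\<close> by one, c(k+1) q^(-(k+1)) = (z/q) c(k). The recurrence thus becomes a
  pure product formula; \<open>theta_qbin_right\<close> works in the same way.\<close>

lemma theta_qbin_left:
  assumes "norm q < 1" "q \<noteq> 0" "z \<noteq> 0"
  shows "(1 - q powi (a + b)) * qbin_sum q 1 (theta_coeff q z) a b
    = (1 + z * q powi (a - 1)) * qbin_sum q 1 (theta_coeff q z) (a - 1) b"
proof -
  let ?c = "theta_coeff q z"
  have "qbin_sum q 1 (\<lambda>k. ?c k * q powi (- 1 * k)) a (b - 1)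
      = qbin_sum q 1 (\<lambda>k. ?c (k + 1) * q powi (- 1 * (k + 1))) (a - 1) b"
    using qbin_sum_shift[of q 1 "\<lambda>k. ?c k * q powi (- 1 * k)" a "b - 1"]
    by (simp only: diff_add_cancel)
  also have "\<dots> = qbin_sum q 1 (\<lambda>k. z / q * ?c k) (a - 1) b"
    using assms by (intro qbin_sum_cong)
      (simp add: theta_coeff_plus_1 power_int_diff power_int_minus divide_simps)
  also have "\<dots> = z / q * qbin_sum q 1 ?c (a - 1) b"
    by (rule qbin_sum_cmult)
  finally have "q powi a * qbin_sum q 1 (\<lambda>k. ?c k * q powi (- 1 * k)) a (b - 1)
      = z * q powi (a - 1) * qbin_sum q 1 ?c (a - 1) b"
    using assms by (simp add: power_int_diff)
  then show ?thesis
    using qbin_sum_pascal_left[OF assms(1,2), of 1 a b ?c] by (simp add: algebra_simps)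
qed

lemma theta_qbin_right:
  assumes "norm q < 1" "q \<noteq> 0" "z \<noteq> 0"
  shows "(1 - q powi (a + b)) * qbin_sum q 1 (theta_coeff q z) a b
    = (1 + q powi b / z) * qbin_sum q 1 (theta_coeff q z) a (b - 1)"
proof -
  let ?c = "theta_coeff q z"
  have "z * qbin_sum q 1 (\<lambda>k. ?c k * q powi (1 * k)) (a - 1) b
      = qbin_sum q 1 (\<lambda>k. ?c (k + 1)) (a - 1) b"
    using assms by (simp add: theta_coeff_plus_1 flip: qbin_sum_cmult)
  also have "\<dots> = qbin_sum q 1 ?c a (b - 1)"
    using qbin_sum_shift[of q 1 ?c a "b - 1"] by simp
  finally have "qbin_sum q 1 (\<lambda>k. ?c k * q powi (1 * k)) (a - 1) b
      = qbin_sum q 1 ?c a (b - 1) / z"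
    using assms by (simp add: divide_simps mult.commute)
  then show ?thesis
    using qbin_sum_pascal_right[OF assms(1,2), of 1 a b ?c] by (simp add: algebra_simps)
qed

text \<open>A form of the q-binomial theorem. Each induction step lowers the first argument and then
  the second, which gives one new factor of each numerator product.\<close>

lemma finite_triple_product:
  assumes q: "norm q < 1" "q \<noteq> 0" "z \<noteq> 0"
  shows "qbin_sum q 1 (theta_coeff q z) (int n) (int n)
    = qpoch (- z) q n * qpoch (- (q / z)) q n / qpoch q q (2 * n)"
proof (induction n)
  case 0
  have "k \<noteq> 0 \<Longrightarrow> qrfact q (- k) * qrfact q k = 0" for k
    by (cases "k > 0") auto
  then have "((\<lambda>k. theta_coeff q z k * (qrfact q (0 - 1 * k) * qrfact q (0 + 1 * k)))
      has_sum 1) UNIV"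
    by (intro has_sum_finite_neutralI[of "{0}"]) (auto simp: qrfact_def)
  then show ?case
    by (simp add: qbin_sum_def infsumI)
next
  case (Suc n)
  let ?H = "qbin_sum q 1 (theta_coeff q z)"
  define N where "N = int (Suc n)"
  have nz: "1 - q * q ^ m \<noteq> 0" for m
    using power_neq_1[OF q(1), of "Suc m"] by simp
  have "nat (N + N) = Suc (2 * n + 1)" "nat (int n + N) = Suc (2 * n)"
    by (simp_all add: N_def)
  then have N: "q powi (N + N) = q * q ^ (2 * n + 1)" "q powi (int n + N) = q * q ^ (2 * n)"
      "q powi (N - 1) = q ^ n" "q powi N = q * q ^ n" "N - 1 = int n"
    by (simp_all add: N_def power_int_def nat_add_distrib)
  have "(1 - q * q ^ (2 * n + 1)) * ?H N N = (1 + z * q ^ n) * ?H (int n) N"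
    using theta_qbin_left[OF q, of N N] unfolding N power_int_of_nat .
  moreover have "(1 - q * q ^ (2 * n)) * ?H (int n) N = (1 + q * q ^ n / z) * ?H (int n) (int n)"
    using theta_qbin_right[OF q, of "N - 1" N] unfolding N power_int_of_nat .
  ultimately have "(1 - q * q ^ (2 * n)) * ((1 - q * q ^ (2 * n + 1)) * ?H N N)
      = (1 + z * q ^ n) * ((1 + q * q ^ n / z) * ?H (int n) (int n))"
    by (simp only: mult.left_commute)
  moreover have "qpoch q q (2 * Suc n)
      = qpoch q q (2 * n) * (1 - q * q ^ (2 * n)) * (1 - q * q ^ (2 * n + 1))"
    by (simp add: qpoch_Suc)
  moreover have "qpoch (- z) q (Suc n) * qpoch (- (q / z)) q (Suc n)
    = (1 + z * q ^ n) * ((1 + q * q ^ n / z) * (qpoch (- z) q n * qpoch (- (q / z)) q n))"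
    by (simp add: qpoch_Suc mult_ac)
  ultimately show ?case
    using nz[of "2 * n"] nz[of "2 * n + 1"] qpoch_self_nonzero[OF q(1), of "2 * n"]
    unfolding Suc N_def[symmetric]
    by (simp only: nonzero_eq_divide_eq mult_eq_0_iff simp_thms times_divide_eq_right mult_ac)
qed

text \<open>Let \<open>n\<close> tend to infinity in \<open>finite_triple_product\<close>. For fixed
  \<open>k\<close> each reciprocal q-factorial tends to \<open>1 / qpoch_inf q q\<close>, and the
  uniform bound on \<open>qrfact\<close> dominates the terms by a constant multiple of the
  absolutely summable theta coefficients.\<close>

theorem jacobi_triple_product:
  assumes q: "norm q < 1" "q \<noteq> 0" "z \<noteq> 0"
  shows "(theta_coeff q z has_sum (qpoch_inf (- z) q * qpoch_inf (- (q / z)) q * qpoch_inf q q)) UNIV"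
proof -
  obtain B where B: "B > 0" "\<And>j. norm (qrfact q j) \<le> B"
    using qrfact_bounded[OF q(1)] by blast
  let ?Q = "qpoch_inf q q"
  have Q: "?Q \<noteq> 0"
    using q power_neq_1[OF q(1), of "Suc n" for n] by (simp add: qpoch_inf_eq_0_iff)
  have lim_rfact: "(\<lambda>n. qrfact q (int n + k)) \<longlonglongrightarrow> inverse ?Q" for k
  proof (rule Lim_transform_eventually)
    have "filterlim (\<lambda>n. nat (int n + k)) at_top sequentially"
    proof (rule filterlim_at_top_mono)
      show "filterlim (\<lambda>n. n - nat \<bar>k\<bar>) at_top sequentially"
        by (rule filterlim_minus_const_nat_at_top)
    qed (auto intro!: always_eventually)
    then show "(\<lambda>n. inverse (qpoch q q (nat (int n + k)))) \<longlonglongrightarrow> inverse ?Q"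
      by (intro tendsto_inverse filterlim_compose[OF qpoch_tendsto] q Q)
    show "eventually (\<lambda>n. inverse (qpoch q q (nat (int n + k))) = qrfact q (int n + k)) sequentially"
      using eventually_ge_at_top[of "nat \<bar>k\<bar>"] by eventually_elim (auto simp: qrfact_def)
  qed
  have "(\<lambda>n. qbin_sum q 1 (theta_coeff q z) (int n) (int n))
      \<longlonglongrightarrow> (\<Sum>\<^sub>\<infinity>k. theta_coeff q z k * (inverse ?Q * inverse ?Q))"
    unfolding qbin_sum_def
  proof (rule tendsto_infsum_dominated)
    fix k
    show "(\<lambda>n. theta_coeff q z k * (qrfact q (int n - 1 * k) * qrfact q (int n + 1 * k)))
        \<longlonglongrightarrow> theta_coeff q z k * (inverse ?Q * inverse ?Q)"
      using lim_rfact[of k] lim_rfact[of "- k"] by (intro tendsto_intros) simp_all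
  next
    fix n k
    show "norm (theta_coeff q z k * (qrfact q (int n - 1 * k) * qrfact q (int n + 1 * k)))
        \<le> norm (theta_coeff q z k) * (B * B)"
      unfolding norm_mult using B by (intro mult_left_mono mult_mono) auto
  qed (intro summable_on_cmult_left theta_coeff_summable q)
  moreover have "(\<lambda>n. qbin_sum q 1 (theta_coeff q z) (int n) (int n))
      \<longlonglongrightarrow> qpoch_inf (- z) q * qpoch_inf (- (q / z)) q / ?Q"
    unfolding finite_triple_product[OF q] using Q
    by (intro tendsto_intros qpoch_tendsto q filterlim_compose[OF qpoch_tendsto])
       (simp_all add: mult_nat_left_at_top)
  ultimately have "(\<Sum>\<^sub>\<infinity>k. theta_coeff q z k * (inverse ?Q * inverse ?Q))
      = qpoch_inf (- z) q * qpoch_inf (- (q / z)) q / ?Q"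
    by (rule LIMSEQ_unique)
  then have "(\<Sum>\<^sub>\<infinity>k. theta_coeff q z k)
      = qpoch_inf (- z) q * qpoch_inf (- (q / z)) q * ?Q"
    unfolding infsum_cmult_left' using Q by (simp add: field_simps)
  moreover have "theta_coeff q z summable_on UNIV"
    using theta_coeff_summable[OF q] by (rule abs_summable_summable)
  ultimately show ?thesis
    by (simp add: has_sum_iff)
qed

subsection \<open>A limit of the q-Gauss sum\<close>

text \<open>General term of the basic hypergeometric series 1phi1(a; az; q, z). Tying the lower
  parameter to \<open>a * z\<close> is the condition under which this limit of the q-Gauss series
  has a product evaluation.\<close>

definition phi11_term :: "complex \<Rightarrow> complex \<Rightarrow> complex \<Rightarrow> nat \<Rightarrow> complex" where
  "phi11_term q a z k =
    qpoch a q k * (- z) ^ k * q ^ (k * (k - 1) div 2) / (qpoch q q k * qpoch (a * z) q k)"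

lemma phi11_term_0 [simp]: "phi11_term q a z 0 = 1"
  by (simp add: phi11_term_def)

text \<open>The constant must not depend on \<open>n\<close>, since \<open>n\<close> later tends to
  infinity; the last factor records the decay in \<open>n\<close> for \<open>k > 0\<close>.\<close>

lemma phi11_term_bound:
  assumes q: "norm q < 1" and az: "\<And>n. a * z * q ^ n \<noteq> 1"
  obtains K where "\<And>n k. norm (phi11_term q a (z * q ^ n) k)
    \<le> K * (norm z ^ k * norm q ^ (k * (k - 1) div 2)) * norm (q ^ n) ^ k"
proof -
  obtain A where A: "A > 0" "\<And>n. norm (qpoch a q n) \<le> A"
    using qpoch_bounded[OF q] by blast
  obtain B where B: "B > 0" "\<And>n. norm (inverse (qpoch q q n)) \<le> B"
    using inverse_qpoch_bounded[of q q] q power_neq_1[of q "Suc n" for n] by auto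
  obtain C where C: "C > 0" "\<And>n. norm (qpoch (a * z) q n) \<le> C"
    using qpoch_bounded[OF q] by blast
  obtain D where D: "D > 0" "\<And>n. norm (inverse (qpoch (a * z) q n)) \<le> D"
    using inverse_qpoch_bounded[OF q az] by blast
  have nz: "qpoch (a * z) q n \<noteq> 0" for n
    using az by (simp add: qpoch_eq_0_iff)
  show thesis
  proof (rule that[of "A * B * C * D"])
    fix n k
    \<comment> \<open>Rewriting the shifted product as a quotient of products with base point
      \<open>a * z\<close> makes a single pair of bounds serve for all \<open>n\<close>.\<close>
    have "inverse (qpoch (a * (z * q ^ n)) q k) = qpoch (a * z) q n * inverse (qpoch (a * z) q (n + k))"
      using nz[of n] by (simp add: qpoch_add mult.assoc)
    then have "phi11_term q a (z * q ^ n) k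
        = (qpoch a q k * inverse (qpoch q q k) * qpoch (a * z) q n
            * inverse (qpoch (a * z) q (n + k)))
          * ((- z) ^ k * q ^ (k * (k - 1) div 2)) * (q ^ n) ^ k"
      unfolding phi11_term_def divide_inverse inverse_mult_distrib
        mult_minus_left[symmetric] power_mult_distrib
      by (simp only: mult_ac)
    also have "norm \<dots> = norm (qpoch a q k) * norm (inverse (qpoch q q k)) * norm (qpoch (a * z) q n)
            * norm (inverse (qpoch (a * z) q (n + k)))
          * (norm z ^ k * norm q ^ (k * (k - 1) div 2)) * norm (q ^ n) ^ k"
      by (simp only: norm_mult norm_power norm_minus_cancel)
    also have "\<dots> \<le> A * B * C * D * (norm z ^ k * norm q ^ (k * (k - 1) div 2)) * norm (q ^ n) ^ k"
      using A B C D by (intro mult_right_mono mult_mono) auto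
    finally show "norm (phi11_term q a (z * q ^ n) k)
      \<le> A * B * C * D * (norm z ^ k * norm q ^ (k * (k - 1) div 2)) * norm (q ^ n) ^ k" .
  qed
qed

lemma phi11_summable:
  assumes q: "norm q < 1" and az: "\<And>n. a * z * q ^ n \<noteq> 1"
  shows "summable (\<lambda>k. norm (phi11_term q a z k))"
proof -
  obtain K where K: "\<And>n k. norm (phi11_term q a (z * q ^ n) k)
      \<le> K * (norm z ^ k * norm q ^ (k * (k - 1) div 2)) * norm (q ^ n) ^ k"
    using phi11_term_bound[OF assms] by blast
  show ?thesis
  proof (rule summable_comparison_test')
    show "summable (\<lambda>k. K * (norm z ^ k * norm q ^ (k * (k - 1) div 2)))"
      using q by (intro summable_mult summable_gauss) auto
    show "norm (norm (phi11_term q a z k)) \<le> K * (norm z ^ k * norm q ^ (k * (k - 1) div 2))" for k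
      using K[of 0 k] by simp
  qed
qed

text \<open>The difference of the two sides telescopes. The boundary terms vanish:
  \<open>v 0 = 0\<close> because of the factor \<open>1 - q ^ k\<close>, and \<open>v\<close> tends
  to 0 with the summands.\<close>

lemma phi11_contiguous:
  assumes q: "norm q < 1" and az: "\<And>n. a * z * q ^ n \<noteq> 1"
  shows "(1 - a * z) * (\<Sum>k. phi11_term q a z k) = (1 - z) * (\<Sum>k. phi11_term q a (z * q) k)"
proof -
  let ?t = "phi11_term q a z" and ?s = "phi11_term q a (z * q)"
  \<comment> \<open>telescoping certificate of the contiguous relation\<close>
  define v where "v = (\<lambda>k. (1 - a * z) * (?t k * (1 - q ^ k)))"
  have nz: "1 - a * z * q ^ k \<noteq> 0" "qpoch (a * z) q k \<noteq> 0" for k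
    using az by (simp_all add: qpoch_eq_0_iff)
  have nz': "1 - q * q ^ k \<noteq> 0" for k
    using power_neq_1[OF q, of "Suc k"] by simp
  have t: "summable (\<lambda>k. norm (?t k))"
    by (rule phi11_summable[OF assms])
  have s: "summable (\<lambda>k. norm (?s k))"
    using az[of "Suc n" for n] by (intro phi11_summable[OF q]) (simp add: mult_ac)
  have step: "(1 - a * z) * ?t k - (1 - z) * ?s k = v k - v (Suc k)" for k
  proof -
    \<comment> \<open>All three terms involved are polynomial multiples of \<open>T\<close> (for
      \<open>?t (Suc k)\<close>, after its factor \<open>1 - q ^ Suc k\<close> is included), so the
      telescoping step reduces to a polynomial identity in Q = q^k.\<close>
    define T where "T = ?t k / (1 - a * z * q ^ k)"
    have "qpoch (a * z) q k * (1 - a * z * q ^ k) = (1 - a * z) * qpoch (a * (z * q)) q k"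
      using qpoch_Suc[of "a * z" q k] qpoch_Suc_left[of "a * z" q k] by (simp add: mult_ac)
    then have d: "qpoch (a * (z * q)) q k = qpoch (a * z) q k * (1 - a * z * q ^ k) / (1 - a * z)"
      using nz(1)[of 0] by (simp add: field_simps)
    have Tt: "?t k = T * (1 - a * z * q ^ k)"
      using nz(1)[of k] by (simp add: T_def)
    have "(- (z * q)) ^ k = (- z) ^ k * q ^ k"
      using power_mult_distrib[of "- z" q k] by simp
    then have "?s k = (1 - a * z) * (T * q ^ k)"
      unfolding T_def phi11_term_def d
      by (simp only: divide_inverse inverse_mult_distrib inverse_inverse_eq mult_ac)
    moreover have "?t (Suc k) * (1 - q ^ Suc k) = - z * q ^ k * (1 - a * q ^ k) * T"
    proof -
      have "Suc k * (Suc k - 1) div 2 = k * (k - 1) div 2 + k"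
        using triangular_Suc[of k] by simp
      then have "?t (Suc k) = (qpoch a q k * (1 - a * q ^ k)) * (- z * (- z) ^ k)
          * (q ^ (k * (k - 1) div 2) * q ^ k)
          / ((qpoch q q k * (1 - q * q ^ k)) * (qpoch (a * z) q k * (1 - a * z * q ^ k)))"
        unfolding phi11_term_def by (simp only: qpoch_Suc power_add power_Suc)
      moreover have "x / ((y * u) * w) * u = x / (y * w)" if "u \<noteq> 0" for x y u w :: complex
        using that by simp
      ultimately have "?t (Suc k) * (1 - q ^ Suc k) = (qpoch a q k * (1 - a * q ^ k)) * (- z * (- z) ^ k)
          * (q ^ (k * (k - 1) div 2) * q ^ k)
          / (qpoch q q k * (qpoch (a * z) q k * (1 - a * z * q ^ k)))"
        using nz'[of k] by (simp only: power_Suc)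
      then show ?thesis
        unfolding T_def phi11_term_def
        by (simp only: divide_inverse inverse_mult_distrib mult_ac)
    qed
    moreover have "(1 - a * z) * (T * (1 - a * z * Q)) - (1 - z) * ((1 - a * z) * (T * Q))
        = (1 - a * z) * (T * (1 - a * z * Q) * (1 - Q)) - (1 - a * z) * (- z * Q * (1 - a * Q) * T)" for Q
      by algebra
    ultimately show ?thesis
      unfolding v_def by (simp only: Tt)
  qed
  have "?t \<longlonglongrightarrow> 0"
    using summable_LIMSEQ_zero[OF t] by (simp add: tendsto_norm_zero_iff)
  moreover have "(\<lambda>k. q ^ k) \<longlonglongrightarrow> 0"
    using q by (rule LIMSEQ_power_zero)
  ultimately have "v \<longlonglongrightarrow> (1 - a * z) * (0 * (1 - 0))"
    unfolding v_def by (intro tendsto_intros q)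
  then have "(\<lambda>k. v k - v (Suc k)) sums 0"
    using telescope_sums'[of v 0] by (simp add: v_def)
  then have "(\<Sum>k. (1 - a * z) * ?t k - (1 - z) * ?s k) = 0"
    unfolding step by (simp add: sums_iff)
  moreover have "(\<Sum>k. (1 - a * z) * ?t k - (1 - z) * ?s k)
      = (1 - a * z) * (\<Sum>k. ?t k) - (1 - z) * (\<Sum>k. ?s k)"
    using summable_norm_cancel[OF t] summable_norm_cancel[OF s]
    by (subst suminf_diff[symmetric]) (simp_all add: suminf_mult summable_mult)
  ultimately show ?thesis by simp
qed

lemma phi11_iterate:
  assumes q: "norm q < 1" and az: "\<And>n. a * z * q ^ n \<noteq> 1"
  shows "qpoch (a * z) q n * (\<Sum>k. phi11_term q a z k)
    = qpoch z q n * (\<Sum>k. phi11_term q a (z * q ^ n) k)"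
proof (induction n)
  case (Suc n)
  have "a * (z * q ^ n) * q ^ m \<noteq> 1" for m
    using az[of "n + m"] by (simp add: power_add mult.assoc)
  from phi11_contiguous[OF q this]
  have "(1 - a * z * q ^ n) * (\<Sum>k. phi11_term q a (z * q ^ n) k)
      = (1 - z * q ^ n) * (\<Sum>k. phi11_term q a (z * q ^ Suc n) k)"
    by (simp add: mult_ac)
  note step = this
  have "qpoch (a * z) q (Suc n) * (\<Sum>k. phi11_term q a z k)
      = (1 - a * z * q ^ n) * (qpoch (a * z) q n * (\<Sum>k. phi11_term q a z k))"
    by (simp only: qpoch_Suc mult_ac)
  also have "\<dots> = qpoch z q n * ((1 - a * z * q ^ n) * (\<Sum>k. phi11_term q a (z * q ^ n) k))"
    unfolding Suc by (simp only: mult_ac)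
  also have "\<dots> = qpoch z q (Suc n) * (\<Sum>k. phi11_term q a (z * q ^ Suc n) k)"
    unfolding step by (simp only: qpoch_Suc mult_ac)
  finally show ?case .
qed simp

text \<open>Iterating the contiguous relation moves the argument to z q^n. As \<open>n\<close> grows
  only the term \<open>k = 0\<close> survives, while the finite products converge to the infinite
  ones.\<close>

theorem phi11_sum:
  assumes q: "norm q < 1" and az: "\<And>n. a * z * q ^ n \<noteq> 1"
  shows "(\<Sum>k. phi11_term q a z k) = qpoch_inf z q / qpoch_inf (a * z) q"
proof -
  obtain K where K: "\<And>n k. norm (phi11_term q a (z * q ^ n) k)
      \<le> K * (norm z ^ k * norm q ^ (k * (k - 1) div 2)) * norm (q ^ n) ^ k"
    using phi11_term_bound[OF assms] by blast
  have K0: "0 \<le> K * (norm z ^ k * norm q ^ (k * (k - 1) div 2))" for k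
    using order_trans[OF norm_ge_zero K[of 0 k]] by simp
  have "(\<lambda>n. \<Sum>k. phi11_term q a (z * q ^ n) k) \<longlonglongrightarrow> (\<Sum>k. if k = 0 then 1 else 0)"
  proof (rule tannerys_theorem[THEN conjunct2, THEN conjunct2])
    fix k
    show "(\<lambda>n. phi11_term q a (z * q ^ n) k) \<longlonglongrightarrow> (if k = 0 then 1 else 0)"
    proof (cases "k = 0")
      case False
      have "(\<lambda>n. K * (norm z ^ k * norm q ^ (k * (k - 1) div 2)) * norm (q ^ n) ^ k) \<longlonglongrightarrow>
          K * (norm z ^ k * norm q ^ (k * (k - 1) div 2)) * norm (0 :: complex) ^ k"
        using q by (intro tendsto_intros LIMSEQ_power_zero)
      then have "(\<lambda>n. K * (norm z ^ k * norm q ^ (k * (k - 1) div 2)) * norm (q ^ n) ^ k) \<longlonglongrightarrow> 0"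
        using False by (simp only: norm_zero power_0_left if_False mult_zero_right)
      with always_eventually[OF allI[OF K]] have "(\<lambda>n. phi11_term q a (z * q ^ n) k) \<longlonglongrightarrow> 0"
        by (rule Lim_null_comparison)
      then show ?thesis using False by simp
    qed simp
  next
    show "summable (\<lambda>k. K * (norm z ^ k * norm q ^ (k * (k - 1) div 2)))"
      using q by (intro summable_mult summable_gauss) auto
    have "norm (phi11_term q a (z * q ^ n) k)
        \<le> K * (norm z ^ k * norm q ^ (k * (k - 1) div 2))" for n k
    proof -
      have "norm (q ^ n) ^ k \<le> 1"
        using q by (simp add: norm_power power_le_one)
      from mult_left_mono[OF this K0[of k]] show ?thesis
        using K[of n k] by simp
    qed
    then show "eventually (\<lambda>(k, n). norm (phi11_term q a (z * q ^ n) k)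
        \<le> K * (norm z ^ k * norm q ^ (k * (k - 1) div 2))) (at_top \<times>\<^sub>F sequentially)"
      by (intro always_eventually) auto
  qed simp
  moreover have "(\<Sum>k. if k = (0::nat) then 1 else 0) = (1 :: complex)"
    using suminf_finite[of "{0::nat}" "\<lambda>k. if k = 0 then 1 else (0::complex)"] by simp
  ultimately have "(\<lambda>n. qpoch z q n * (\<Sum>k. phi11_term q a (z * q ^ n) k)) \<longlonglongrightarrow> qpoch_inf z q * 1"
    by (intro tendsto_mult qpoch_tendsto q) simp
  moreover have "(\<lambda>n. qpoch (a * z) q n * (\<Sum>k. phi11_term q a z k))
      \<longlonglongrightarrow> qpoch_inf (a * z) q * (\<Sum>k. phi11_term q a z k)"
    by (intro tendsto_intros qpoch_tendsto q)
  ultimately have "qpoch_inf (a * z) q * (\<Sum>k. phi11_term q a z k) = qpoch_inf z q"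
    unfolding phi11_iterate[OF assms] using LIMSEQ_unique by fastforce
  moreover have "qpoch_inf (a * z) q \<noteq> 0"
    using az by (simp add: qpoch_inf_eq_0_iff q)
  ultimately show ?thesis
    by (simp add: field_simps)
qed

section \<open>The conjugate Bailey pair\<close>

lemma one_plus_power_neq_0:
  fixes q :: complex
  assumes "norm q < 1"
  shows "1 + q ^ n \<noteq> 0"
proof
  assume *: "1 + q ^ n = 0"
  then have "q ^ n = - 1"
    by (simp only: add_eq_0_iff)
  then have "q ^ (n * 2) = 1"
    unfolding power_mult by simp
  then have "n = 0"
    using power_neq_1[OF assms, of "n * 2"] by auto
  then show False using * by simp
qed

lemma triangular_add:
  "(r + k) * (r + k + 1) div 2 = r * (r + 1) div 2 + ((r + 1) * k + k * (k - 1) div 2)" for r k :: nat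
proof (induction k)
  case (Suc k)
  have "(r + Suc k) * (r + Suc k + 1) div 2 = (r + k) * (r + k + 1) div 2 + (r + k + 1)"
    using triangular_Suc[of "r + k + 1"] by (simp add: mult.commute)
  then show ?case
    unfolding Suc using triangular_Suc[of k] by (simp add: algebra_simps)
qed simp

text \<open>Terms with \<open>n < r\<close> vanish. After n = k + r the sum is a constant times
  1phi1 with a = -q^r and z = -q^(r+1), hence a z = q^(2r+1), and \<open>phi11_sum\<close> evaluates
  it.\<close>

lemma conjugate_bailey_nat:
  assumes q: "norm q < 1"
  shows "((\<lambda>n. qpoch (- 1) q n * q ^ (n * (n + 1) div 2)
      * (qrfact q (int n - int r) * qrfact q (int n + int r)))
    has_sum (2 / phi_neg q * (q ^ (r * (r + 1) div 2) / (1 + q ^ r)))) UNIV"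
proof -
  let ?f = "\<lambda>n. qpoch (- 1) q n * q ^ (n * (n + 1) div 2)
      * (qrfact q (int n - int r) * qrfact q (int n + int r))"
  let ?a = "- (q ^ r)" and ?z = "- (q ^ (r + 1))"
  let ?c = "qpoch (- 1) q r * q ^ (r * (r + 1) div 2) / qpoch q q (2 * r)"
  have az: "?a * ?z = q * q ^ (2 * r)"
    by (simp add: mult_2 power_add)
  have "q * q ^ (2 * r) * q ^ n \<noteq> 1" for n
    using power_neq_1[OF q, of "Suc (2 * r + n)"] by (simp add: power_add mult.assoc)
  then have nz: "?a * ?z * q ^ n \<noteq> 1" for n
    unfolding az .
  have term_eq: "?f (k + r) = ?c * phi11_term q ?a ?z k" for k
  proof -
    have "qrfact q (int (k + r) - int r) = inverse (qpoch q q k)"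
      by (simp add: qrfact_of_nat)
    moreover have "qrfact q (int (k + r) + int r) = inverse (qpoch q q (2 * r + k))"
      by (simp add: qrfact_of_nat[symmetric] add_ac)
    moreover have "q ^ ((k + r) * (k + r + 1) div 2)
        = q ^ (r * (r + 1) div 2) * ((q ^ (r + 1)) ^ k * q ^ (k * (k - 1) div 2))"
      unfolding add.commute[of k r] triangular_add power_add[of q "r * (r + 1) div 2"]
        power_add[of q "(r + 1) * k"] power_mult by simp
    moreover have "qpoch (- 1) q (k + r) = qpoch (- 1) q r * qpoch ?a q k"
      unfolding add.commute[of k r] qpoch_add by simp
    ultimately show ?thesis
      unfolding phi11_term_def az qpoch_add by (simp add: divide_inverse mult_ac)
  qed
  have "phi11_term q ?a ?z sums (qpoch_inf ?z q / qpoch_inf (q * q ^ (2 * r)) q)"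
    using phi11_sum[OF q nz] summable_sums[OF summable_norm_cancel[OF phi11_summable[OF q nz]]]
    unfolding az by simp
  then have "(phi11_term q ?a ?z has_sum (qpoch_inf ?z q / qpoch_inf (q * q ^ (2 * r)) q)) UNIV"
    by (rule norm_summable_imp_has_sum[OF phi11_summable[OF q nz]])
  then have "((\<lambda>k. ?f (k + r)) has_sum (?c * (qpoch_inf ?z q / qpoch_inf (q * q ^ (2 * r)) q))) UNIV"
    unfolding term_eq by (rule has_sum_cmult_right)
  then have "(?f has_sum (?c * (qpoch_inf ?z q / qpoch_inf (q * q ^ (2 * r)) q))) ((\<lambda>k. k + r) ` UNIV)"
    by (subst has_sum_reindex) (simp_all add: o_def)
  then have "(?f has_sum (?c * (qpoch_inf ?z q / qpoch_inf (q * q ^ (2 * r)) q))) UNIV"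
  proof (subst has_sum_cong_neutral[where g = ?f and T = "range (\<lambda>k. k + r)"])
    fix n assume "n \<in> UNIV - range (\<lambda>k. k + r)"
    then have "n < r"
      by (metis DiffE le_add_diff_inverse2 not_less rangeI)
    then show "?f n = 0" by simp
  qed auto
  moreover have "?c * (qpoch_inf ?z q / qpoch_inf (q * q ^ (2 * r)) q)
      = 2 / phi_neg q * (q ^ (r * (r + 1) div 2) / (1 + q ^ r))"
  proof -
    have 0: "1 + q ^ r \<noteq> 0"
      using q by (rule one_plus_power_neq_0)
    \<comment> \<open>Both sides come from factoring (-1; q)_(r+1) at its last and at its first
      factor; this is the source of the 2 and of the denominator 1 + q^r.\<close>
    have 1: "qpoch (- 1) q r = 2 * qpoch (- q) q r / (1 + q ^ r)"
      using qpoch_Suc[of "- 1" q r] qpoch_Suc_left[of "- 1" q r] 0 by (simp add: field_simps)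
    have 2: "qpoch_inf (- q) q = qpoch (- q) q r * qpoch_inf ?z q"
      using qpoch_inf_split[OF q, of "- q" r] by simp
    have 3: "qpoch_inf q q = qpoch q q (2 * r) * qpoch_inf (q * q ^ (2 * r)) q"
      by (rule qpoch_inf_split[OF q])
    show ?thesis
      unfolding phi_neg_def 1 2 3 by (simp add: divide_simps)
  qed
  ultimately show ?thesis by simp
qed

text \<open>The summand is even in \<open>m\<close>, and so is the value: for m = -r the exponent
  drops by r, which 1 + q^(-r) = (1 + q^r) / q^r compensates.\<close>

lemma conjugate_bailey:
  assumes q: "norm q < 1" "q \<noteq> 0"
  shows "((\<lambda>n. qpoch (- 1) q n * q ^ (n * (n + 1) div 2)
      * (qrfact q (int n - m) * qrfact q (int n + m)))
    has_sum (2 / phi_neg q * (q powi (m * (m + 1) div 2) / (1 + q powi m)))) UNIV"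
proof (cases m rule: int_cases2)
  case (nonneg r)
  have "m * (m + 1) div 2 = int (r * (r + 1) div 2)"
    by (simp add: nonneg zdiv_int algebra_simps)
  then show ?thesis
    using conjugate_bailey_nat[OF q(1), of r] by (simp add: nonneg)
next
  case (nonpos r)
  have "m * (m + 1) = int (r * (r + 1)) + (- int r) * 2"
    by (simp add: nonpos algebra_simps)
  then have "m * (m + 1) div 2 = (int (r * (r + 1)) + (- int r) * 2) div 2"
    by (rule arg_cong)
  also have "\<dots> = int (r * (r + 1) div 2) - int r"
    by (subst div_mult_self1) (simp_all only: zdiv_int, simp_all)
  finally have "q powi (m * (m + 1) div 2) / (1 + q powi m)
      = q ^ (r * (r + 1) div 2) / q ^ r / (1 + inverse (q ^ r))"
    using q by (simp add: nonpos power_int_diff power_int_minus)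
  also have "\<dots> = q ^ (r * (r + 1) div 2) / (1 + q ^ r)"
    using q by (simp add: divide_simps) (simp add: add.commute)
  finally show ?thesis
    using conjugate_bailey_nat[OF q(1), of r] by (simp add: nonpos mult.commute)
qed

subsection \<open>Interchanging the summations\<close>

lemma has_sum_diff:
  fixes f g :: "'a \<Rightarrow> 'b::topological_ab_group_add"
  assumes "(f has_sum a) A" "(g has_sum b) A"
  shows "((\<lambda>x. f x - g x) has_sum (a - b)) A"
  using has_sum_add[OF assms(1), of "\<lambda>x. - g x" "- b"] assms(2) by (simp add: has_sum_uminus)

lemma one_plus_power_int_neq_0:
  fixes q :: complex
  assumes "norm q < 1" "q \<noteq> 0"
  shows "1 + q powi m \<noteq> 0"
proof (cases m rule: int_cases2)
  case (nonneg n)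
  then show ?thesis using one_plus_power_neq_0[OF assms(1), of n] by simp
next
  case (nonpos n)
  have "1 + q powi m = (1 + q ^ n) / q ^ n"
    using assms by (simp add: nonpos power_int_minus field_simps)
  then show ?thesis using one_plus_power_neq_0[OF assms(1), of n] assms by simp
qed

lemma phi_neg_neq_0:
  assumes "norm q < 1"
  shows "phi_neg q \<noteq> 0"
proof -
  have "q * q ^ n \<noteq> 1" "- q * q ^ n \<noteq> 1" for n
    using power_neq_1[OF assms, of "Suc n"] one_plus_power_neq_0[OF assms, of "Suc n"]
    by (simp, metis add.commute add_minus_cancel minus_mult_left power_Suc add_0)
  then show ?thesis
    by (simp add: phi_neg_def qpoch_inf_eq_0_iff[OF assms])
qed

text \<open>This is \<alpha> at index 3k, and \<open>bailey_coeff1\<close> is \<alpha> at index 3k +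
  1, for the difference of A(7) and A(5). They equal -q^(3k^2-k) (1 - q^(3k)) and q^(3k^2+k) (1 -
  q^(3k+1)).\<close>

definition bailey_coeff0 :: "complex \<Rightarrow> int \<Rightarrow> complex" where
  "bailey_coeff0 q k = q powi (3 * k\<^sup>2 + 2 * k) - q powi (3 * k\<^sup>2 - k)"

definition bailey_coeff1 :: "complex \<Rightarrow> int \<Rightarrow> complex" where
  "bailey_coeff1 q k = q powi (3 * k\<^sup>2 + k) - q powi (3 * k\<^sup>2 + 4 * k + 1)"

text \<open>Entry of the double series: summed over \<open>k\<close> it produces the Bailey pair,
  summed over \<open>n\<close> the conjugate pair.\<close>

definition bailey_summand :: "complex \<Rightarrow> nat \<Rightarrow> int \<Rightarrow> complex" where
  "bailey_summand q n k = qpoch (- 1) q n * q ^ (n * (n + 1) div 2)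
    * (bailey_coeff0 q k * (qrfact q (int n - 3 * k) * qrfact q (int n + 3 * k))
      + bailey_coeff1 q k * (qrfact q (int n - (3 * k + 1)) * qrfact q (int n + (3 * k + 1))))"

lemma bailey_summand_has_sum_int:
  assumes q: "norm q < 1" "q \<noteq> 0"
  shows "(bailey_summand q n has_sum
    (qpoch (- 1) q n * q ^ (n * (n + 1) div 2) * ((1 - q ^ n) * (q ^ (n\<^sup>2 - n) / qpoch q q (2 * n))))) UNIV"
proof -
  let ?w = "\<lambda>a b k. qrfact q (a - 3 * k) * qrfact q (b + 3 * k)"
  let ?N = "int n"
  have "((\<lambda>k. (q powi (3 * k\<^sup>2 + 2 * k) * ?w ?N ?N k
          - q powi (3 * k\<^sup>2 + 4 * k + 1) * ?w (?N - 1) (?N + 1) k)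
        - (q powi (3 * k\<^sup>2 - k) * ?w ?N ?N k
          - q powi (3 * k\<^sup>2 + k) * ?w (?N - 1) (?N + 1) k)) has_sum
      (slater_A7 q ?N ?N - slater_A5 q ?N ?N)) UNIV"
    unfolding slater_A7_def slater_A5_def
    by (intro has_sum_diff qbin_term_has_sum) simp_all
  moreover have "slater_A7 q ?N ?N - slater_A5 q ?N ?N
      = (1 - q ^ n) * (q ^ (n\<^sup>2 - n) / qpoch q q (2 * n))"
    unfolding slater_A5_eq_A7[OF q] slater_A7_closed[OF q] by (simp only: left_diff_distrib mult_1)
  ultimately have "((\<lambda>k. qpoch (- 1) q n * q ^ (n * (n + 1) div 2) *
      ((q powi (3 * k\<^sup>2 + 2 * k) * ?w ?N ?N k
          - q powi (3 * k\<^sup>2 + 4 * k + 1) * ?w (?N - 1) (?N + 1) k)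
        - (q powi (3 * k\<^sup>2 - k) * ?w ?N ?N k
          - q powi (3 * k\<^sup>2 + k) * ?w (?N - 1) (?N + 1) k))) has_sum
      (qpoch (- 1) q n * q ^ (n * (n + 1) div 2) * ((1 - q ^ n) * (q ^ (n\<^sup>2 - n) / qpoch q q (2 * n))))) UNIV"
    by (intro has_sum_cmult_right) simp
  moreover have "bailey_summand q n = (\<lambda>k. qpoch (- 1) q n * q ^ (n * (n + 1) div 2) *
      ((q powi (3 * k\<^sup>2 + 2 * k) * ?w ?N ?N k
          - q powi (3 * k\<^sup>2 + 4 * k + 1) * ?w (?N - 1) (?N + 1) k)
        - (q powi (3 * k\<^sup>2 - k) * ?w ?N ?N k
          - q powi (3 * k\<^sup>2 + k) * ?w (?N - 1) (?N + 1) k)))"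
  proof
    fix k
    \<comment> \<open>The offset \<open>(a - 1, b + 1)\<close> in the second sums of the Slater
      pairs is the same as moving the index from 3k to 3k + 1.\<close>
    have "?N - (3 * k + 1) = ?N - 1 - 3 * k" "?N + (3 * k + 1) = ?N + 1 + 3 * k" by simp_all
    then show "bailey_summand q n k = qpoch (- 1) q n * q ^ (n * (n + 1) div 2) *
      ((q powi (3 * k\<^sup>2 + 2 * k) * ?w ?N ?N k
          - q powi (3 * k\<^sup>2 + 4 * k + 1) * ?w (?N - 1) (?N + 1) k)
        - (q powi (3 * k\<^sup>2 - k) * ?w ?N ?N k
          - q powi (3 * k\<^sup>2 + k) * ?w (?N - 1) (?N + 1) k))"
      unfolding bailey_summand_def bailey_coeff0_def bailey_coeff1_def
      by (simp only: ring_distribs) algebra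
  qed
  ultimately show ?thesis by (simp only:)
qed

text \<open>Apply \<open>conjugate_bailey\<close> at m = 3k and m = 3k + 1. The factor 1 - x in the
  coefficients, with x = q^m, meets the denominator 1 + x, and (1 - x)/(1 + x) = 2/(1 + x) - 1
  separates the theta terms from the terms of the second series.\<close>

lemma bailey_summand_has_sum_nat:
  assumes q: "norm q < 1" "q \<noteq> 0"
  defines "c \<equiv> 2 / phi_neg q"
  shows "((\<lambda>n. bailey_summand q n k) has_sum
    (c * ((q powi ((15 * k\<^sup>2 + k) div 2) - q powi ((15 * k\<^sup>2 + 11 * k) div 2 + 1))
      - 2 * (q powi ((15 * k\<^sup>2 + k) div 2) / (1 + q powi (3 * k))
        - q powi ((15 * k\<^sup>2 + 11 * k) div 2 + 1) / (1 + q powi (3 * k + 1)))))) UNIV"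
proof -
  let ?g = "\<lambda>m. c * (q powi (m * (m + 1) div 2) / (1 + q powi m))"
  have "((\<lambda>n. bailey_coeff0 q k * (qpoch (- 1) q n * q ^ (n * (n + 1) div 2)
          * (qrfact q (int n - 3 * k) * qrfact q (int n + 3 * k)))
        + bailey_coeff1 q k * (qpoch (- 1) q n * q ^ (n * (n + 1) div 2)
          * (qrfact q (int n - (3 * k + 1)) * qrfact q (int n + (3 * k + 1)))))
      has_sum (bailey_coeff0 q k * ?g (3 * k) + bailey_coeff1 q k * ?g (3 * k + 1))) UNIV"
    unfolding c_def by (intro has_sum_add has_sum_cmult_right conjugate_bailey q)
  moreover have "bailey_summand q n k =
      bailey_coeff0 q k * (qpoch (- 1) q n * q ^ (n * (n + 1) div 2)
          * (qrfact q (int n - 3 * k) * qrfact q (int n + 3 * k)))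
        + bailey_coeff1 q k * (qpoch (- 1) q n * q ^ (n * (n + 1) div 2)
          * (qrfact q (int n - (3 * k + 1)) * qrfact q (int n + (3 * k + 1))))" for n
    unfolding bailey_summand_def by (simp only: distrib_left mult_ac)
  moreover have "bailey_coeff0 q k * ?g (3 * k) = c * (q powi ((15 * k\<^sup>2 + k) div 2)
      - 2 * (q powi ((15 * k\<^sup>2 + k) div 2) / (1 + q powi (3 * k))))"
  proof -
    have "(15 * k\<^sup>2 + k) div 2 = (3 * k * (3 * k + 1) + (3 * k\<^sup>2 - k) * 2) div 2"
      by (rule arg_cong[of _ _ "\<lambda>x. x div 2"]) (simp add: power2_eq_square algebra_simps)
    also have "\<dots> = 3 * k\<^sup>2 - k + 3 * k * (3 * k + 1) div 2"
      by (subst div_mult_self1) simp_all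
    finally have "q powi ((15 * k\<^sup>2 + k) div 2)
        = q powi (3 * k\<^sup>2 - k) * q powi (3 * k * (3 * k + 1) div 2)"
      using q by (simp only: power_int_add simp_thms)
    moreover have "q powi (3 * k\<^sup>2 + 2 * k) = q powi (3 * k\<^sup>2 - k) * q powi (3 * k)"
      using q by (simp add: algebra_simps flip: power_int_add)
    moreover have "(E * x - E) * (c * (F / (1 + x))) = c * (E * F - 2 * (E * F / (1 + x)))"
      if "1 + x \<noteq> 0" for E F x :: complex
      using that by (simp add: field_simps)
    ultimately show ?thesis
      unfolding bailey_coeff0_def using one_plus_power_int_neq_0[OF q, of "3 * k"] by (simp only:)
  qed
  moreover have "bailey_coeff1 q k * ?g (3 * k + 1) =
      - c * (q powi ((15 * k\<^sup>2 + 11 * k) div 2 + 1)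
      - 2 * (q powi ((15 * k\<^sup>2 + 11 * k) div 2 + 1) / (1 + q powi (3 * k + 1))))"
  proof -
    have "(15 * k\<^sup>2 + 11 * k) div 2 + 1 = (15 * k\<^sup>2 + 11 * k + 1 * 2) div 2"
      by (subst div_mult_self1) simp_all
    also have "\<dots> = ((3 * k + 1) * (3 * k + 1 + 1) + (3 * k\<^sup>2 + k) * 2) div 2"
      by (rule arg_cong[of _ _ "\<lambda>x. x div 2"]) (simp add: power2_eq_square algebra_simps)
    also have "\<dots> = 3 * k\<^sup>2 + k + (3 * k + 1) * (3 * k + 1 + 1) div 2"
      by (subst div_mult_self1) simp_all
    finally have "q powi ((15 * k\<^sup>2 + 11 * k) div 2 + 1)
        = q powi (3 * k\<^sup>2 + k) * q powi ((3 * k + 1) * (3 * k + 1 + 1) div 2)"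
      using q by (simp only: power_int_add simp_thms)
    moreover have "q powi (3 * k\<^sup>2 + 4 * k + 1) = q powi (3 * k\<^sup>2 + k) * q powi (3 * k + 1)"
      using q by (simp add: algebra_simps flip: power_int_add)
    moreover have "(E - E * x) * (c * (F / (1 + x))) = - c * (E * F - 2 * (E * F / (1 + x)))"
      if "1 + x \<noteq> 0" for E F x :: complex
      using that by (simp add: field_simps)
    ultimately show ?thesis
      unfolding bailey_coeff1_def using one_plus_power_int_neq_0[OF q, of "3 * k + 1"] by (simp only:)
  qed
  ultimately show ?thesis
    by (simp only: ring_distribs) (simp add: algebra_simps)
qed

lemma norm_power_int_le_1:
  fixes q :: complex
  assumes "norm q < 1" "n \<ge> 0"
  shows "norm (q powi n) \<le> 1"
  using assms by (simp add: norm_power_int power_int_le_one)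

text \<open>The four exponents factor into linear forms that never take strictly opposite signs at
  an integer, so no negative power of \<open>q\<close> occurs.\<close>

lemma norm_bailey_coeff:
  assumes "norm q < 1"
  shows "norm (bailey_coeff0 q k) \<le> 2" "norm (bailey_coeff1 q k) \<le> 2"
proof -
  have "0 \<le> k * (3 * k + 2)" "0 \<le> k * (3 * k - 1)" "0 \<le> k * (3 * k + 1)"
      "0 \<le> (3 * k + 1) * (k + 1)"
    by (auto simp: zero_le_mult_iff)
  then have "0 \<le> 3 * k\<^sup>2 + 2 * k" "0 \<le> 3 * k\<^sup>2 - k" "0 \<le> 3 * k\<^sup>2 + k" "0 \<le> 3 * k\<^sup>2 + 4 * k + 1"
    by (simp_all add: power2_eq_square algebra_simps)
  from this[THEN norm_power_int_le_1[OF assms]]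
  show "norm (bailey_coeff0 q k) \<le> 2" "norm (bailey_coeff1 q k) \<le> 2"
    unfolding bailey_coeff0_def bailey_coeff1_def
    by (auto intro!: order_trans[OF norm_triangle_ineq4])
qed

lemma bailey_summand_summable:
  assumes q: "norm q < 1" "q \<noteq> 0"
  shows "(\<lambda>(n, k). bailey_summand q n k) summable_on UNIV \<times> UNIV"
proof -
  obtain A where A: "A > 0" "\<And>n. norm (qpoch (- 1) q n) \<le> A"
    using qpoch_bounded[OF q(1)] by blast
  obtain B where B: "B > 0" "\<And>j. norm (qrfact q j) \<le> B"
    using qrfact_bounded[OF q(1)] by blast
  define K where "K = A * (2 * (B * B) + 2 * (B * B))"
  have K: "K \<ge> 0" using A B by (simp add: K_def)
  \<comment> \<open>The entries vanish for |k| > n, and n(n+1)/2 >= n gives geometric decay for the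
    remaining ones.\<close>
  define G where "G = (\<lambda>(n::nat, k::int). if \<bar>k\<bar> \<le> int n then K * norm q ^ n else 0)"
  have bound: "norm (bailey_summand q n k) \<le> G (n, k)" for n k
  proof (cases "\<bar>k\<bar> \<le> int n")
    case True
    have "n \<le> n * (n + 1) div 2"
      by (cases n) (simp_all add: less_eq_div_iff_mult_less_eq)
    then have "norm (q ^ (n * (n + 1) div 2)) \<le> norm q ^ n"
      unfolding norm_power using q by (intro power_decreasing) auto
    then have "norm (bailey_summand q n k) \<le> A * norm q ^ n * (2 * (B * B) + 2 * (B * B))"
      unfolding bailey_summand_def norm_mult
      using A B norm_bailey_coeff[OF q(1)]
      by (intro mult_mono order_trans[OF norm_triangle_ineq] add_mono) (auto simp: norm_mult intro!: mult_mono)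
    then show ?thesis
      using True by (simp add: G_def K_def mult_ac)
  next
    case False
    then consider "k > int n" | "k < - int n" by linarith
    then have "bailey_summand q n k = 0"
      by cases (simp_all add: bailey_summand_def)
    then show ?thesis using K by (simp add: G_def)
  qed
  have "G summable_on UNIV \<times> UNIV"
  proof (rule summable_on_SigmaI)
    fix n :: nat
    show "((\<lambda>k. G (n, k)) has_sum (\<Sum>k\<in>{- int n..int n}. K * norm q ^ n)) UNIV"
      by (rule has_sum_finite_neutralI[of "{- int n..int n}"])
        (auto simp: G_def simp del: sum_constant intro!: sum.cong)
  next
    \<comment> \<open>Row \<open>n\<close> of \<open>G\<close> has 2n + 1 nonzero places at most, so
      its sum is at most 2K (n + 1) |q|^n, a multiple of a term of the differentiated geometric
      series.\<close>
    have "summable (\<lambda>n. of_nat (Suc n) * norm q ^ n)"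
      using geometric_deriv_sums[of "norm q"] q by (auto simp: sums_iff)
    then have "summable (\<lambda>n. 2 * K * (of_nat (Suc n) * norm q ^ n))"
      by (rule summable_mult)
    then have "summable (\<lambda>n. \<Sum>k\<in>{- int n..int n}. K * norm q ^ n)"
      by (rule summable_comparison_test')
        (use K in \<open>auto simp: algebra_simps nat_add_distrib intro!: mult_right_mono\<close>)
    then show "(\<lambda>n. \<Sum>k\<in>{- int n..int n}. K * norm q ^ n) summable_on UNIV"
      using K by (subst summable_on_UNIV_nonneg_real_iff) (auto intro!: sum_nonneg)
  qed (use K in \<open>auto simp: G_def\<close>)
  then have "(\<lambda>x. norm (case x of (n, k) \<Rightarrow> bailey_summand q n k)) summable_on UNIV \<times> UNIV"
    by (rule Infinite_Sum.abs_summable_on_comparison_test') (use bound in auto)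
  then show ?thesis by (rule abs_summable_summable)
qed

section \<open>The two theta series to the base q^15\<close>

lemma theta_has_sum:
  assumes q: "norm q < 1" "q \<noteq> 0"
  shows "((\<lambda>k. q powi ((15 * k\<^sup>2 + k) div 2)) has_sum
      qpoch_inf_list [- (q ^ 7), - (q ^ 8), q ^ 15] (q ^ 15)) UNIV"
    and "((\<lambda>k. q powi ((15 * k\<^sup>2 + 11 * k) div 2)) has_sum
      qpoch_inf_list [- (q ^ 2), - (q ^ 13), q ^ 15] (q ^ 15)) UNIV"
proof -
  have p: "norm (q ^ 15) < 1" "q ^ 15 \<noteq> 0"
    using q by (simp_all add: norm_power power_less_one_iff)
  \<comment> \<open>The linear coefficient 2j - 15 is 1 for j = 8 and 11 for j = 13, which dictates
    the choices of \<open>z\<close> below; q^15 / z supplies the remaining parameters q^7 and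
    q^2.\<close>
  have coeff: "theta_coeff (q ^ 15) (q ^ j) k = q powi ((15 * k\<^sup>2 + (2 * int j - 15) * k) div 2)" for j k
  proof -
    have ev: "even (k * (k - 1))" by simp
    have "15 * k\<^sup>2 + (2 * int j - 15) * k = 15 * (k * (k - 1)) + int j * k * 2"
      by (simp add: power2_eq_square algebra_simps)
    then have "(15 * k\<^sup>2 + (2 * int j - 15) * k) div 2 = int j * k + 15 * (k * (k - 1)) div 2"
      by (simp only: div_mult_self1 zero_neq_numeral[symmetric])
    also have "\<dots> = int j * k + 15 * (k * (k - 1) div 2)"
      using ev by (simp only: div_mult_swap)
    finally show ?thesis
      using q by (simp add: theta_coeff_def power_int_add power_int_power)
  qed
  have r: "q ^ 15 / q ^ 8 = q ^ 7" "q ^ 15 / q ^ 13 = q ^ 2"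
    using q by (simp_all add: power_diff[symmetric])
  show "((\<lambda>k. q powi ((15 * k\<^sup>2 + k) div 2)) has_sum
      qpoch_inf_list [- (q ^ 7), - (q ^ 8), q ^ 15] (q ^ 15)) UNIV"
    using jacobi_triple_product[OF p, of "q ^ 8"] q
    by (simp add: coeff[abs_def] r qpoch_inf_list_def mult_ac)
  show "((\<lambda>k. q powi ((15 * k\<^sup>2 + 11 * k) div 2)) has_sum
      qpoch_inf_list [- (q ^ 2), - (q ^ 13), q ^ 15] (q ^ 15)) UNIV"
    using jacobi_triple_product[OF p, of "q ^ 13"] q
    by (simp add: coeff[abs_def] r qpoch_inf_list_def mult_ac)
qed

section \<open>Comparing the two iterated sums of the double series\<close>

theorem corollary19:
  fixes q :: complex
  assumes "0 < norm q" and "norm q < 1"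
  shows "\<exists>S T.
    (\<lambda>n::nat. qpoch (- q) q n / qpoch q q (2 * n + 1)
        * (q ^ ((3 * n\<^sup>2 + 5 * n) div 2 + 1) / (1 + q ^ (n + 1)))) sums S \<and>
    ((\<lambda>n::int. q powi ((15 * n\<^sup>2 + n) div 2) / (1 + q powi (3 * n))
        - q powi ((15 * n\<^sup>2 + 11 * n) div 2 + 1) / (1 + q powi (3 * n + 1))) has_sum T) UNIV \<and>
    S + 2 / phi_neg q * T
      = 1 / phi_neg q *
          (qpoch_inf_list [- (q ^ 7), - (q ^ 8), q ^ 15] (q ^ 15)
           - q * qpoch_inf_list [- (q ^ 2), - (q ^ 13), q ^ 15] (q ^ 15))"
proof -
  have q: "norm q < 1" "q \<noteq> 0" using assms by auto
  let ?s = "\<lambda>n::nat. qpoch (- q) q n / qpoch q q (2 * n + 1)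
        * (q ^ ((3 * n\<^sup>2 + 5 * n) div 2 + 1) / (1 + q ^ (n + 1)))"
  let ?t = "\<lambda>n::int. q powi ((15 * n\<^sup>2 + n) div 2) / (1 + q powi (3 * n))
        - q powi ((15 * n\<^sup>2 + 11 * n) div 2 + 1) / (1 + q powi (3 * n + 1))"
  let ?\<theta> = "\<lambda>n::int. q powi ((15 * n\<^sup>2 + n) div 2) - q powi ((15 * n\<^sup>2 + 11 * n) div 2 + 1)"
  let ?\<phi> = "phi_neg q"
  let ?\<Theta> = "qpoch_inf_list [- (q ^ 7), - (q ^ 8), q ^ 15] (q ^ 15)
           - q * qpoch_inf_list [- (q ^ 2), - (q ^ 13), q ^ 15] (q ^ 15)"
  let ?g = "\<lambda>n. qpoch (- 1) q n * q ^ (n * (n + 1) div 2)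
    * ((1 - q ^ n) * (q ^ (n\<^sup>2 - n) / qpoch q q (2 * n)))"
  let ?h = "\<lambda>k. 2 / ?\<phi> * (?\<theta> k - 2 * ?t k)"
  obtain I where I: "((\<lambda>(n, k). bailey_summand q n k) has_sum I) (UNIV \<times> UNIV)"
    using bailey_summand_summable[OF q] by (auto simp: summable_on_def)
  have "(?g has_sum I) UNIV"
    by (rule has_sum_SigmaD[OF I]) (unfold prod.case, rule bailey_summand_has_sum_int[OF q])
  then have "?g sums I"
    by (rule has_sum_imp_sums)
  \<comment> \<open>The term at 0 vanishes through the factor 1 - q^0, so dropping it leaves the
    value unchanged.\<close>
  then have "(\<lambda>n. ?g (Suc n)) sums I"
    by (subst sums_Suc_iff) simp
  \<comment> \<open>The factor 2 comes from (-1; q)_(n+1) = 2 (-q; q)_n. In the denominator 1 -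
    q^(2n+2) splits, its factor 1 - q^(n+1) cancels, and 1 + q^(n+1) remains.\<close>
  moreover have g_Suc: "?g (Suc n) = 2 * ?s n" for n
  proof -
    have "Suc n * (Suc n + 1) div 2 + ((Suc n)\<^sup>2 - Suc n) = (3 * n\<^sup>2 + 5 * n) div 2 + 1"
    proof -
      have "Suc n * (Suc n + 1) div 2 + ((Suc n)\<^sup>2 - Suc n) = (Suc n * (Suc n + 1) + (n\<^sup>2 + n) * 2) div 2"
        by (subst div_mult_self1) (simp_all add: power2_eq_square)
      also have "\<dots> = (3 * n\<^sup>2 + 5 * n + 1 * 2) div 2"
        by (rule arg_cong[of _ _ "\<lambda>x. x div 2"]) (simp add: power2_eq_square algebra_simps)
      also have "\<dots> = (3 * n\<^sup>2 + 5 * n) div 2 + 1"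
        by (subst div_mult_self1) simp_all
      finally show ?thesis .
    qed
    then have e: "q ^ (Suc n * (Suc n + 1) div 2) * q ^ ((Suc n)\<^sup>2 - Suc n)
        = q ^ ((3 * n\<^sup>2 + 5 * n) div 2 + 1)"
      by (simp only: power_add[symmetric])
    have nz: "1 - q ^ Suc n \<noteq> 0" "1 + q ^ Suc n \<noteq> 0"
      using power_neq_1[OF q(1), of "Suc n"] one_plus_power_neq_0[OF q(1), of "Suc n"] by auto
    have "qpoch (- 1) q (Suc n) = 2 * qpoch (- q) q n"
      by (simp add: qpoch_Suc_left)
    moreover have "qpoch q q (2 * Suc n) = qpoch q q (2 * n + 1) * ((1 - q ^ Suc n) * (1 + q ^ Suc n))"
    proof -
      have "q * q ^ (2 * n + 1) = q ^ Suc n * q ^ Suc n"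
        by (simp add: mult_2 power_add)
      then have "1 - q * q ^ (2 * n + 1) = (1 - q ^ Suc n) * (1 + q ^ Suc n)"
        by (simp only: left_diff_distrib distrib_left) simp
      then show ?thesis
        using qpoch_Suc[of q q "2 * n + 1"] by simp
    qed
    moreover have "(2 * a) * X * (u * (Y / (b * (u * v)))) = 2 * (a / b * (X * Y / v))"
      if "u \<noteq> 0" for a X u Y b v :: complex
      using that by simp
    ultimately show ?thesis
      using nz unfolding Suc_eq_plus1[symmetric] e[symmetric, unfolded Suc_eq_plus1[symmetric]]
      by (simp only: simp_thms)
  qed
  ultimately have "(\<lambda>n. 2 * ?s n) sums I" by simp
  then have S: "?s sums (I / 2)"
    using sums_divide[of "\<lambda>n. 2 * ?s n" I 2] by simp
  have I': "((\<lambda>(k, n). bailey_summand q n k) has_sum I) (UNIV \<times> UNIV)"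
    using I by (subst (asm) has_sum_swap) simp
  have "(?h has_sum I) UNIV"
    by (rule has_sum_SigmaD[OF I']) (unfold prod.case, rule bailey_summand_has_sum_nat[OF q])
  \<comment> \<open>Solving the definition of \<open>?h\<close> for \<open>?t\<close> gives
    \<open>?t\<close> as half of \<open>?\<theta>\<close> minus this multiple of \<open>?h\<close>.
    Convergence of the second series thus follows from that of the other two.\<close>
  then have "((\<lambda>k. ?\<phi> / 4 * ?h k) has_sum (?\<phi> / 4 * I)) UNIV"
    by (rule has_sum_cmult_right)
  moreover have "(?\<theta> has_sum ?\<Theta>) UNIV"
  proof -
    have "((\<lambda>n. q * q powi ((15 * n\<^sup>2 + 11 * n) div 2)) has_sum
        (q * qpoch_inf_list [- (q ^ 2), - (q ^ 13), q ^ 15] (q ^ 15))) UNIV"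
      by (intro has_sum_cmult_right theta_has_sum q)
    moreover have "q * q powi j = q powi (j + 1)" for j
      using q by (simp add: power_int_add_1')
    ultimately show ?thesis
      by (intro has_sum_diff theta_has_sum q) simp
  qed
  then have "((\<lambda>k. 1 / 2 * ?\<theta> k) has_sum (1 / 2 * ?\<Theta>)) UNIV"
    by (rule has_sum_cmult_right)
  ultimately have "((\<lambda>k. 1 / 2 * ?\<theta> k - ?\<phi> / 4 * ?h k) has_sum (1 / 2 * ?\<Theta> - ?\<phi> / 4 * I)) UNIV"
    by (intro has_sum_diff)
  moreover have "1 / 2 * x - ?\<phi> / 4 * (2 / ?\<phi> * (x - 2 * y)) = y" for x y
    using phi_neg_neq_0[OF q(1)] by (simp add: field_simps)
  ultimately have T: "(?t has_sum (1 / 2 * ?\<Theta> - ?\<phi> / 4 * I)) UNIV"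
    by (simp only:)
  have "I / 2 + 2 / ?\<phi> * (1 / 2 * X - ?\<phi> / 4 * I) = 1 / ?\<phi> * X" for X
    using phi_neg_neq_0[OF q(1)] by (simp add: field_simps)
  with S T show ?thesis by blast
qed

end
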